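(* Let $n\ge 1$ and let $\Sigma_0,\Sigma_1\subset\mathbb{S}^{n+1}$ be closed (compact, without boundary) embedded minimal hypersurfaces of the round unit sphere $\mathbb{S}^{n+1}$. Let $\mathbb{S}^{n+1}_+\subset\mathbb{S}^{n+1}$ be any open hemisphere, i.e. $\mathbb{S}^{n+1}_+=\{x\in\mathbb{S}^{n+1}\subset\mathbb{R}^{n+2}:\langle x,a\rangle>0\}$ for some $a\in\mathbb{S}^{n+1}$. Then $$\overline{\mathbb{S}^{n+1}_+}\cap\Sigma_0\cap\Sigma_1\neq\emptyset.$$ *)

theory Defs
  imports "HOL-Analysis.Analysis"
begin

text \<open>Unit sphere S^{n+1} in R^{n+2}; the ambient space R^{n+2} is real^'n
  with CARD('n) = n+2.\<close>

definition sph_grad :: "(real^'n::finite \<Rightarrow> real^'n) \<Rightarrow> real^'n \<Rightarrow> real^'n" where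
  "sph_grad g x = g x - (g x \<bullet> x) *\<^sub>R x"

definition sph_normal :: "(real^'n::finite \<Rightarrow> real^'n) \<Rightarrow> real^'n \<Rightarrow> real^'n" where
  "sph_normal g x = (1 / norm (sph_grad g x)) *\<^sub>R sph_grad g x"

definition C2_with_grad :: "(real^'n::finite) set \<Rightarrow> (real^'n \<Rightarrow> real) \<Rightarrow> (real^'n \<Rightarrow> real^'n) \<Rightarrow> bool" where
  "C2_with_grad U F g \<longleftrightarrow>
     open U \<and>
     (\<forall>x\<in>U. (F has_derivative (\<lambda>h. g x \<bullet> h)) (at x)) \<and>
     (\<exists>g'. (\<forall>x\<in>U. (g has_derivative g' x) (at x)) \<and>
           (\<forall>v. continuous_on U (\<lambda>x. g' x v)))"

text \<open>Spherical divergence (= trace of the covariant derivative on T_x S^{n+1})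
  of a vector field with Euclidean derivative D at x on the sphere.\<close>
definition sph_div :: "(real^'n::finite \<Rightarrow> real^'n) \<Rightarrow> real^'n \<Rightarrow> real" where
  "sph_div D x = (\<Sum>i\<in>UNIV. D (axis i 1) $ i) - (D x \<bullet> x)"

text \<open>A closed (compact, boundaryless) embedded C^2 hypersurface of the unit sphere
  with vanishing mean curvature: locally a regular level set {x \<in> S. F x = 0},
  and the mean curvature H = div_S(nu) of the unit normal nu vanishes.\<close>
definition closed_embedded_minimal_hypersurface :: "(real^'n::finite) set \<Rightarrow> bool" where
  "closed_embedded_minimal_hypersurface \<Sigma> \<longleftrightarrow>
     \<Sigma> \<noteq> {} \<and> \<Sigma> \<subseteq> sphere 0 1 \<and> compact \<Sigma> \<and>
     (\<forall>p\<in>\<Sigma>. \<exists>U F g. p \<in> U \<and> C2_with_grad U F g \<and>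
        \<Sigma> \<inter> U = {x \<in> U \<inter> sphere 0 1. F x = 0} \<and>
        (\<forall>x\<in>\<Sigma> \<inter> U. sph_grad g x \<noteq> 0) \<and>
        (\<forall>x\<in>\<Sigma> \<inter> U. \<exists>D. (sph_normal g has_derivative D) (at x) \<and> sph_div D x = 0))"

end

theory Submission
  imports Defs
begin

text \<open>Write \<open>H\<close> for the closed hemisphere \<open>x \<bullet> a \<ge> 0\<close> and suppose that \<open>\<Sigma>0\<close> and \<open>\<Sigma>1\<close> are disjoint in
  \<open>H\<close>. By compactness \<open>x \<bullet> y < m\<close> on \<open>(\<Sigma>0 \<inter> H) \<times> (\<Sigma>1 \<inter> H)\<close> for some \<open>m < 1\<close>. Maximise
  \<open>(x \<bullet> a) (y \<bullet> a) / (m - x \<bullet> y)\<close> there. The quotient vanishes when \<open>x\<close> or \<open>y\<close> is on the equator, so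
  (once both hypersurfaces enter the open hemisphere) the maximum is at interior points \<open>p\<close>, \<open>q\<close>.
  With \<open>1 / c\<close> the maximal value, the bilinear form \<open>f x y = x \<bullet> y + c (x \<bullet> a) (y \<bullet> a)\<close> satisfies
  \<open>f \<le> m\<close>, with equality at \<open>(p, q)\<close>. By minimality, the trace of the second variation of \<open>f\<close> along
  paired orthonormal frames \<open>e\<^sub>i\<close>, \<open>e'\<^sub>i\<close> of the two tangent spaces says \<open>\<Sum> f e\<^sub>i e'\<^sub>i \<le> n m < n\<close>. But
  criticality determines the tangent spaces as \<open>{p, B q}\<^sup>\<bottom>\<close> and \<open>{q, B p}\<^sup>\<bottom>\<close> with \<open>B = I + c a a\<^sup>T\<close>, and
  these have frames with \<open>f e\<^sub>i e'\<^sub>i \<ge> 1\<close> for all \<open>i\<close>.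

  If a hypersurface only touches the equator from below, \<open>a\<close> is first tilted slightly, which
  preserves disjointness in \<open>H\<close>.\<close>

section \<open>Orthonormal systems, traces and adapted frames\<close>

lemma orthonormal_expansion:
  fixes X :: "'a::euclidean_space set"
  assumes "pairwise orthogonal X" "\<And>x. x \<in> X \<Longrightarrow> norm x = 1" "card X = DIM('a)"
  shows "y = (\<Sum>x\<in>X. (y \<bullet> x) *\<^sub>R x)"
proof -
  have "0 \<notin> X"
    using assms(2) by force
  then have ind: "independent X"
    using assms(1) pairwise_orthogonal_independent by blast
  then have fin: "finite X"
    using finiteI_independent by blast
  have sp: "span X = UNIV"
    using card_ge_dim_independent[of X UNIV] ind assms(3) by auto
  define r where "r = y - (\<Sum>x\<in>X. (y \<bullet> x) *\<^sub>R x)"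
  have "orthogonal r x" if "x \<in> X" for x
  proof -
    have "(\<Sum>z\<in>X. (y \<bullet> z) * (z \<bullet> x)) = (\<Sum>z\<in>X. if z = x then y \<bullet> x else 0)"
      using assms(1,2) that
      by (intro sum.cong) (auto simp: pairwise_def orthogonal_def norm_eq_1)
    then show ?thesis
      using fin that by (simp add: r_def orthogonal_def inner_diff_left inner_sum_left)
  qed
  then have "orthogonal r r"
    using orthogonal_to_span[of r X r] sp by auto
  then show ?thesis
    by (simp add: r_def orthogonal_def)
qed

text \<open>Basis independence of the trace. It allows \<open>sph_div\<close>, which is written with
  the coordinate axes, to be evaluated on a frame made of the point, the normal and tangent
  vectors.\<close>

lemma orthonormal_trace:
  fixes D :: "real^'n \<Rightarrow> real^'n"
  assumes "linear D" "pairwise orthogonal X" "\<And>x. x \<in> X \<Longrightarrow> norm x = 1" "card X = CARD('n)"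
  shows "(\<Sum>x\<in>X. D x \<bullet> x) = (\<Sum>i\<in>UNIV. D (axis i 1) $ i)"
proof -
  have ex: "y = (\<Sum>x\<in>X. (y \<bullet> x) *\<^sub>R x)" for y
    using assms by (intro orthonormal_expansion) auto
  have "D (axis i 1) $ i = (\<Sum>x\<in>X. x $ i * D x $ i)" for i
  proof -
    have "D (axis i 1) = (\<Sum>x\<in>X. (axis i 1 \<bullet> x) *\<^sub>R D x)"
      by (subst ex) (simp add: linear_sum[OF assms(1)] linear_cmul[OF assms(1)])
    then show ?thesis
      by (simp add: inner_axis')
  qed
  then have "(\<Sum>i\<in>UNIV. D (axis i 1) $ i) = (\<Sum>x\<in>X. \<Sum>i\<in>UNIV. x $ i * D x $ i)"
    by (simp add: sum.swap[of _ X])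
  then show ?thesis
    by (simp add: inner_vec_def mult.commute)
qed

lemma orthonormal_complement:
  fixes S :: "'a::euclidean_space set"
  assumes "pairwise orthogonal S" "\<And>s. s \<in> S \<Longrightarrow> norm s = 1"
  obtains E where "pairwise orthogonal E" "\<And>e. e \<in> E \<Longrightarrow> norm e = 1"
    "\<And>e s. e \<in> E \<Longrightarrow> s \<in> S \<Longrightarrow> e \<bullet> s = 0" "card E + card S = DIM('a)" "finite E"
proof -
  have "0 \<notin> S"
    using assms(2) by force
  then have ind: "independent S"
    using assms(1) pairwise_orthogonal_independent by blast
  define V where "V = {y \<in> UNIV. \<forall>x \<in> span S. orthogonal x y}"
  have "subspace V"
    unfolding V_def using subspace_orthogonal_to_vectors[of "span S"] by simp
  then obtain E where E: "E \<subseteq> V" "pairwise orthogonal E" "\<And>x. x \<in> E \<Longrightarrow> norm x = 1"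
    "independent E" "card E = dim V"
    by (metis orthonormal_basis_subspace)
  have "dim V + dim (span S) = DIM('a)"
    unfolding V_def by (subst dim_subspace_orthogonal_to_vectors) auto
  then have "card E + card S = DIM('a)"
    using E(5) ind by (simp add: dim_eq_card_independent)
  moreover have "e \<bullet> s = 0" if "e \<in> E" "s \<in> S" for e s
    using E(1) that span_base[of s S] by (auto simp: V_def orthogonal_def inner_commute)
  ultimately show thesis
    using that E finiteI_independent by blast
qed

text \<open>A Gram-Schmidt step that tolerates degeneracy: if \<open>x\<close> already lies in the
  span of \<open>S\<close>, any unit vector orthogonal to \<open>S\<close> serves as
  \<open>f\<close>, with coefficient zero. Degenerate positions of \<open>a\<close>,
  \<open>p\<close>, \<open>q\<close> thus need no separate treatment later.\<close>

lemma orthonormal_step: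
  fixes S :: "'a::euclidean_space set"
  assumes S: "pairwise orthogonal S" "\<And>s. s \<in> S \<Longrightarrow> norm s = 1" "finite S"
    and card: "card S < DIM('a)"
  obtains f where "norm f = 1" "\<And>s. s \<in> S \<Longrightarrow> f \<bullet> s = 0"
    "(\<Sum>s\<in>S. (x \<bullet> s) *\<^sub>R s) + (x \<bullet> f) *\<^sub>R f = x"
proof -
  define r where "r = x - (\<Sum>s\<in>S. (x \<bullet> s) *\<^sub>R s)"
  have r: "r \<bullet> s = 0" if "s \<in> S" for s
  proof -
    have "(\<Sum>z\<in>S. (x \<bullet> z) * (z \<bullet> s)) = (\<Sum>z\<in>S. if z = s then x \<bullet> s else 0)"
      using S(1,2) that
      by (intro sum.cong) (auto simp: pairwise_def orthogonal_def norm_eq_1)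
    then show ?thesis
      using S(3) that by (simp add: r_def inner_diff_left inner_sum_left)
  qed
  have "\<exists>f. norm f = 1 \<and> (\<forall>s\<in>S. f \<bullet> s = 0) \<and> (\<exists>k. r = k *\<^sub>R f)"
  proof (cases "r = 0")
    case True
    obtain E where E: "\<And>e. e \<in> E \<Longrightarrow> norm e = 1"
      "\<And>e s. e \<in> E \<Longrightarrow> s \<in> S \<Longrightarrow> e \<bullet> s = 0" "card E + card S = DIM('a)"
      using orthonormal_complement[OF S(1,2)] by metis
    then obtain f where "f \<in> E"
      using card by fastforce
    then show ?thesis
      using True E by (intro exI[of _ f]) auto
  next
    case False
    then show ?thesis
      using r by (intro exI[of _ "(1 / norm r) *\<^sub>R r"]) (auto intro!: exI[of _ "norm r"])
  qed
  then obtain f k where f: "norm f = 1" "\<And>s. s \<in> S \<Longrightarrow> f \<bullet> s = 0" "r = k *\<^sub>R f"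
    by blast
  have "(\<Sum>s\<in>S. (x \<bullet> s) *\<^sub>R s) \<bullet> f = 0"
    using f(2) by (simp add: inner_sum_right inner_commute[of _ f])
  then have "x \<bullet> f = r \<bullet> f"
    by (simp add: r_def inner_diff_left)
  then have "x \<bullet> f = k"
    using f by (simp add: dot_square_norm)
  then show thesis
    using that[OF f(1,2)] f(3) by (simp add: r_def algebra_simps)
qed

text \<open>\<open>E\<close> spans the complement of a three-dimensional space containing
  \<open>a\<close>, \<open>p\<close>, \<open>q\<close>; it lies in both tangent spaces, and on it
  the form is the plain inner product. Inside the three-dimensional space each tangent space leaves
  one direction, given by a cross product. The last inequality holds because
  \<open>G\<^sup>2 - (r \<bullet> r) * (r' \<bullet> r')\<close> is a nonnegative multiple of the
  Gram determinant of \<open>a\<close>, \<open>p\<close>, \<open>q\<close>.\<close>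

lemma adapted_frames:
  fixes a p q :: "'a::euclidean_space"
  assumes dim: "DIM('a) \<ge> 3" and a: "norm a = 1" and p: "norm p = 1" and q: "norm q = 1"
    and c: "c > 0" and pa: "p \<bullet> a > 0" and qa: "q \<bullet> a > 0"
    and m: "m = p \<bullet> q + c * (p \<bullet> a) * (q \<bullet> a)" "0 \<le> m" "m < 1"
  obtains E e e' where "pairwise orthogonal E" "\<And>x. x \<in> E \<Longrightarrow> norm x = 1" "card E + 3 = DIM('a)"
    "finite E" "\<And>x. x \<in> E \<Longrightarrow> x \<bullet> p = 0 \<and> x \<bullet> q = 0 \<and> x \<bullet> a = 0 \<and> x \<bullet> e = 0 \<and> x \<bullet> e' = 0"
    "norm e = 1" "norm e' = 1" "e \<bullet> p = 0" "e \<bullet> q + c * (e \<bullet> a) * (q \<bullet> a) = 0"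
    "e' \<bullet> q = 0" "p \<bullet> e' + c * (p \<bullet> a) * (e' \<bullet> a) = 0"
    "e \<bullet> e' + c * (e \<bullet> a) * (e' \<bullet> a) \<ge> 1"
proof -
  obtain f where f: "norm f = 1" "f \<bullet> a = 0" "(p \<bullet> a) *\<^sub>R a + (p \<bullet> f) *\<^sub>R f = p"
    using orthonormal_step[of "{a}" p] a dim by auto
  have af: "a \<noteq> f"
    using f a by (auto simp: norm_eq_1)
  have "pairwise orthogonal {a, f}" "\<And>s. s \<in> {a, f} \<Longrightarrow> norm s = 1" "card {a, f} < DIM('a)"
    using f(1,2) a dim af by (auto simp: pairwise_insert orthogonal_def inner_commute)
  then obtain h where h': "norm h = 1" "\<And>s. s \<in> {a, f} \<Longrightarrow> h \<bullet> s = 0"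
    "(\<Sum>s\<in>{a, f}. (q \<bullet> s) *\<^sub>R s) + (q \<bullet> h) *\<^sub>R h = q"
    using orthonormal_step[of "{a, f}" q] by blast
  have h: "norm h = 1" "h \<bullet> a = 0" "h \<bullet> f = 0"
    "(q \<bullet> a) *\<^sub>R a + (q \<bullet> f) *\<^sub>R f + (q \<bullet> h) *\<^sub>R h = q"
    using h' af by simp_all
  have ortho: "pairwise orthogonal {a, f, h}"
    using f(2) h(2,3) by (auto simp: pairwise_insert orthogonal_def inner_commute)
  have distinct: "a \<noteq> h" "f \<noteq> h"
    using h f a by (auto simp: norm_eq_1)
  obtain E where E: "pairwise orthogonal E" "\<And>e. e \<in> E \<Longrightarrow> norm e = 1"
    "\<And>e s. e \<in> E \<Longrightarrow> s \<in> {a, f, h} \<Longrightarrow> e \<bullet> s = 0" "card E + card {a, f, h} = DIM('a)" "finite E"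
    using orthonormal_complement[OF ortho] a f(1) h(1) by auto
  define V where "V \<alpha> \<beta> \<gamma> = \<alpha> *\<^sub>R a + \<beta> *\<^sub>R f + \<gamma> *\<^sub>R h" for \<alpha> \<beta> \<gamma>
  have VV: "V \<alpha> \<beta> \<gamma> \<bullet> V \<alpha>' \<beta>' \<gamma>' = \<alpha> * \<alpha>' + \<beta> * \<beta>' + \<gamma> * \<gamma>'" for \<alpha> \<beta> \<gamma> \<alpha>' \<beta>' \<gamma>'
    using a f(1,2) h(1,2,3) inner_commute[of a f] inner_commute[of a h] inner_commute[of f h]
    unfolding V_def by (simp add: inner_add_left inner_add_right norm_eq_1)
  have aV: "a = V 1 0 0"
    by (simp add: V_def)
  define u s v y z where "u = p \<bullet> a" and "s = p \<bullet> f" and "v = q \<bullet> a" and "y = q \<bullet> f" and "z = q \<bullet> h"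
  have pV: "p = V u s 0" and qV: "q = V v y z"
    using f(3) h(4) by (simp_all add: V_def u_def s_def v_def y_def z_def)
  have ps: "u\<^sup>2 + s\<^sup>2 = 1" and qs: "v\<^sup>2 + y\<^sup>2 + z\<^sup>2 = 1"
    using p q unfolding norm_eq_1 pV qV VV by (simp_all add: power2_eq_square)
  have m': "m = u * v + s * y + c * u * v"
    using m(1) unfolding u_def[symmetric] v_def[symmetric] unfolding pV qV VV by simp
  \<comment> \<open>In the coordinates of the frame, with \<open>B = I + c a a\<^sup>T\<close>, these are
    \<open>p \<times> B q\<close> and \<open>B p \<times> q\<close>.\<close>
  define r where "r = V (s * z) (- u * z) (u * y - (1 + c) * s * v)"
  define r' where "r' = V (s * z) (- (1 + c) * u * z) ((1 + c) * u * y - s * v)"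
  \<comment> \<open>The form evaluated before normalisation; the inequality to reach is
    \<open>norm r * norm r' \<le> G\<close>.\<close>
  define G where "G = r \<bullet> r' + c * (r \<bullet> a) * (r' \<bullet> a)"
  define \<kappa> where "\<kappa> = c * (2 + c)"
  have uv: "u > 0" "v > 0" and \<kappa>: "\<kappa> > 0" and M: "1 - m\<^sup>2 > 0"
    using pa qa c m(2,3) by (simp_all add: u_def v_def \<kappa>_def power_less_one_iff abs_square_less_1)
  have ss: "s\<^sup>2 = 1 - u\<^sup>2" and yz: "y\<^sup>2 + z\<^sup>2 = 1 - v\<^sup>2"
    using ps qs by simp_all
  \<comment> \<open>Lagrange's identity: the squared length of \<open>p \<times> B q\<close> is the
    product of the squared lengths minus the square of \<open>p \<bullet> B q = m\<close>.\<close>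
  have "r \<bullet> r = (u\<^sup>2 + s\<^sup>2) * ((1 + c)\<^sup>2 * v\<^sup>2 + (y\<^sup>2 + z\<^sup>2)) - m\<^sup>2"
    unfolding r_def VV m' by (simp add: algebra_simps power2_eq_square)
  then have rr: "r \<bullet> r = 1 - m\<^sup>2 + \<kappa> * v\<^sup>2"
    unfolding ps yz \<kappa>_def by (simp add: algebra_simps power2_eq_square)
  have "r' \<bullet> r' = (v\<^sup>2 + y\<^sup>2 + z\<^sup>2) * ((1 + c)\<^sup>2 * u\<^sup>2 + s\<^sup>2) - m\<^sup>2"
    unfolding r'_def VV m' by (simp add: algebra_simps power2_eq_square)
  then have rr': "r' \<bullet> r' = 1 - m\<^sup>2 + \<kappa> * u\<^sup>2"
    unfolding qs ss \<kappa>_def by (simp add: algebra_simps power2_eq_square)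
  have "G = (1 + c) * (u\<^sup>2 + s\<^sup>2) * (v\<^sup>2 + y\<^sup>2 + z\<^sup>2) - ((1 + c) * m - \<kappa> * u * v) * m"
    unfolding G_def r_def r'_def aV VV m' \<kappa>_def by (simp add: algebra_simps power2_eq_square)
  then have G: "G = (1 + c) * (1 - m\<^sup>2) + \<kappa> * m * u * v"
    unfolding ps qs by (simp add: algebra_simps power2_eq_square)
  \<comment> \<open>The left side is the Gram determinant of \<open>a\<close>, \<open>p\<close>,
    \<open>q\<close> with \<open>p \<bullet> q\<close> replaced by \<open>m - c * u * v\<close>. It
    equals the square of \<open>s * z\<close>, the determinant of their triangular coordinate
    matrix.\<close>
  have "1 - m\<^sup>2 + 2 * (1 + c) * m * u * v - \<kappa> * u\<^sup>2 * v\<^sup>2 - u\<^sup>2 - v\<^sup>2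
      = (1 - u\<^sup>2) * (1 - v\<^sup>2) - s\<^sup>2 * y\<^sup>2"
    unfolding m' \<kappa>_def by (simp add: algebra_simps power2_eq_square)
  also have "\<dots> = (s * z)\<^sup>2"
    unfolding ss[symmetric] yz[symmetric] by (simp add: algebra_simps power_mult_distrib)
  finally have gram: "1 - m\<^sup>2 + 2 * (1 + c) * m * u * v - \<kappa> * u\<^sup>2 * v\<^sup>2 - u\<^sup>2 - v\<^sup>2 = (s * z)\<^sup>2" .
  have "G\<^sup>2 - (r \<bullet> r) * (r' \<bullet> r') = \<kappa> * (1 - m\<^sup>2) *
      (1 - m\<^sup>2 + 2 * (1 + c) * m * u * v - \<kappa> * u\<^sup>2 * v\<^sup>2 - u\<^sup>2 - v\<^sup>2)"
    unfolding G rr rr' \<kappa>_def by (simp add: algebra_simps power2_eq_square)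
  then have "G\<^sup>2 - (r \<bullet> r) * (r' \<bullet> r') = \<kappa> * (1 - m\<^sup>2) * (s * z)\<^sup>2"
    unfolding gram .
  moreover have "\<kappa> * (1 - m\<^sup>2) * (s * z)\<^sup>2 \<ge> 0"
    using \<kappa> M by (intro mult_nonneg_nonneg) auto
  ultimately have "(norm r * norm r')\<^sup>2 \<le> G\<^sup>2"
    by (simp add: power_mult_distrib power2_norm_eq_inner)
  moreover have "G \<ge> 0"
    unfolding G using c \<kappa> M m(2) uv by (intro add_nonneg_nonneg mult_nonneg_nonneg) auto
  ultimately have Gr: "norm r * norm r' \<le> G"
    using power2_le_imp_le by blast
  \<comment> \<open>Already \<open>m < 1\<close> gives this, so the cross products survive even when
    \<open>a\<close>, \<open>p\<close>, \<open>q\<close> are linearly dependent.\<close>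
  have "r \<bullet> r > 0" "r' \<bullet> r' > 0"
    unfolding rr rr' using M \<kappa> uv by (auto intro!: add_pos_nonneg)
  then have nz: "r \<noteq> 0" "r' \<noteq> 0"
    by auto
  define e e' where "e = (1 / norm r) *\<^sub>R r" and "e' = (1 / norm r') *\<^sub>R r'"
  have perp: "x \<bullet> V \<alpha> \<beta> \<gamma> = 0" if "x \<in> E" for x \<alpha> \<beta> \<gamma>
    using E(3)[OF that] by (simp add: V_def inner_add_right)
  show thesis
  proof
    show "card E + 3 = DIM('a)"
      using E(4) af distinct by simp
    show "x \<bullet> p = 0 \<and> x \<bullet> q = 0 \<and> x \<bullet> a = 0 \<and> x \<bullet> e = 0 \<and> x \<bullet> e' = 0" if "x \<in> E" for x
      unfolding pV qV e_def e'_def r_def r'_def using perp[OF that] E(3)[OF that] by simp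
    show "norm e = 1" "norm e' = 1"
      using nz by (simp_all add: e_def e'_def)
    have "r \<bullet> p = 0" "r' \<bullet> q = 0" "r \<bullet> q + c * (r \<bullet> a) * v = 0" "p \<bullet> r' + c * u * (r' \<bullet> a) = 0"
      unfolding r_def r'_def pV qV aV VV by (simp_all add: algebra_simps)
    then show "e \<bullet> p = 0" "e' \<bullet> q = 0" "e \<bullet> q + c * (e \<bullet> a) * (q \<bullet> a) = 0"
      "p \<bullet> e' + c * (p \<bullet> a) * (e' \<bullet> a) = 0"
      using nz unfolding e_def e'_def v_def u_def by (simp_all add: field_simps)
    have "e \<bullet> e' + c * (e \<bullet> a) * (e' \<bullet> a) = G / (norm r * norm r')"
      using nz unfolding e_def e'_def G_def by (simp add: field_simps)
    then show "e \<bullet> e' + c * (e \<bullet> a) * (e' \<bullet> a) \<ge> 1"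
      using Gr nz by simp
  qed (use E in auto)
qed

section \<open>Curves in a hypersurface of the sphere, to second order\<close>

lemma sph_grad_eq_normal: "sph_grad g x = norm (sph_grad g x) *\<^sub>R sph_normal g x"
  by (simp add: sph_normal_def)

text \<open>Where \<open>sph_grad\<close> vanishes, division by zero makes \<open>sph_normal\<close>
  equal to 0, so the bound holds on the whole space. Hence the length of the normal field is
  globally maximal wherever it is 1.\<close>

lemma norm_sph_normal_le: "norm (sph_normal g x) \<le> 1"
  by (simp add: sph_normal_def)

lemma sph_normal_orthogonal: "norm x = 1 \<Longrightarrow> sph_normal g x \<bullet> x = 0"
  by (simp add: sph_normal_def sph_grad_def inner_diff_left dot_square_norm)

text \<open>Along the projected curve the derivative of \<open>F\<close> is a nonnegative factor
  times \<open>sph_normal g (c t) \<bullet> y' t\<close>. This product vanishes at 0 and has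
  derivative \<open>D v \<bullet> v + 2 * k\<close> there, so its sign for small positive
  \<open>t\<close> is known, and monotonicity passes it on to \<open>F\<close>. Second-order
  information enters only through the derivative of the unit normal at \<open>p\<close>.\<close>

lemma level_function_sign:
  fixes F :: "real^'n \<Rightarrow> real" and g :: "real^'n \<Rightarrow> real^'n" and p v :: "real^'n"
  defines "\<nu> \<equiv> sph_normal g p"
  assumes U: "open U" "p \<in> U"
    and dF: "\<And>x. x \<in> U \<Longrightarrow> (F has_derivative (\<lambda>h. g x \<bullet> h)) (at x)"
    and Fp: "F p = 0" and p: "norm p = 1"
    and dN: "(sph_normal g has_derivative D) (at p)"
    and v: "v \<bullet> p = 0" "v \<bullet> \<nu> = 0" and \<nu>: "norm \<nu> = 1"
    and sign: "\<sigma> * (D v \<bullet> v + 2 * k) > 0"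
  shows "\<forall>\<^sub>F t in at_right 0. \<sigma> * F (sgn (p + t *\<^sub>R v + (t\<^sup>2 * k) *\<^sub>R \<nu>)) > 0"
proof -
  define y where "y t = p + t *\<^sub>R v + (t\<^sup>2 * k) *\<^sub>R \<nu>" for t
  define y' where "y' t = v + (2 * t * k) *\<^sub>R \<nu>" for t
  \<comment> \<open>\<open>R t\<close> is the squared length of \<open>y t\<close>, because
    \<open>p\<close>, \<open>v\<close>, \<open>\<nu>\<close> are mutually orthogonal. So
    \<open>\<rho>\<close> normalises and \<open>c\<close> is the curve projected to the
    sphere.\<close>
  define R where "R t = 1 + t\<^sup>2 * (v \<bullet> v) + t^4 * k\<^sup>2" for t
  define \<rho> where "\<rho> t = 1 / sqrt (R t)" for t
  define \<rho>' where "\<rho>' t = - (t * (v \<bullet> v) + 2 * t^3 * k\<^sup>2) / (R t * sqrt (R t))" for t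
  define c where "c t = \<rho> t *\<^sub>R y t" for t
  define c' where "c' t = \<rho> t *\<^sub>R y' t + \<rho>' t *\<^sub>R y t" for t
  have \<nu>p: "\<nu> \<bullet> p = 0"
    unfolding \<nu>_def using p by (rule sph_normal_orthogonal)
  have comm: "p \<bullet> v = 0" "p \<bullet> \<nu> = 0" "\<nu> \<bullet> v = 0"
    using v \<nu>p by (simp_all add: inner_commute)
  have pp: "p \<bullet> p = 1" "\<nu> \<bullet> \<nu> = 1"
    using p \<nu> by (simp_all add: norm_eq_1)
  have Rpos: "R t > 0" for t
    unfolding R_def by (intro add_pos_nonneg mult_nonneg_nonneg) auto
  have yy: "y t \<bullet> y t = R t" for t
    using v \<nu>p comm pp
    by (simp add: y_def R_def inner_add_left inner_add_right power2_eq_square power4_eq_xxxx)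
  have yy': "y t \<bullet> y' t = t * (v \<bullet> v) + 2 * t^3 * k\<^sup>2" for t
    using v \<nu>p comm pp
    by (simp add: y_def y'_def inner_add_left inner_add_right power2_eq_square power3_eq_cube)
  have c_sgn: "sgn (y t) = c t" for t
    by (simp add: c_def \<rho>_def sgn_div_norm norm_eq_sqrt_inner yy divide_inverse)
  have d\<rho>: "(\<rho> has_real_derivative \<rho>' t) (at t)" for t
  proof -
    have "(R has_real_derivative 2 * (t * (v \<bullet> v) + 2 * t^3 * k\<^sup>2)) (at t)"
      unfolding R_def by (auto intro!: derivative_eq_intros)
    then have "(\<rho> has_real_derivative - ((2 * (t * (v \<bullet> v) + 2 * t^3 * k\<^sup>2)) * (inverse (sqrt (R t)) / 2))
        / (sqrt (R t) * sqrt (R t))) (at t)"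
      unfolding \<rho>_def using Rpos[of t] by (auto intro!: derivative_eq_intros)
    moreover have "- ((2 * (t * (v \<bullet> v) + 2 * t^3 * k\<^sup>2)) * (inverse (sqrt (R t)) / 2))
        / (sqrt (R t) * sqrt (R t)) = \<rho>' t"
      using Rpos[of t] by (simp add: \<rho>'_def field_simps)
    ultimately show ?thesis
      by simp
  qed
  have dy: "(y has_vector_derivative y' t) (at t)" for t
    unfolding y_def y'_def by (auto intro!: derivative_eq_intros)
  have dc: "(c has_vector_derivative c' t) (at t)" for t
    unfolding c_def c'_def
    by (rule has_vector_derivative_eq_rhs[OF has_vector_derivative_scaleR[OF d\<rho> dy]]) simp
  have c_unit: "norm (c t) = 1" for t
    using Rpos[of t] yy[of t] unfolding c_sgn[symmetric] norm_sgn by auto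
  have cc': "c t \<bullet> c' t = 0" for t
  proof -
    have "\<rho> t * (y t \<bullet> y' t) + \<rho>' t * (y t \<bullet> y t) = 0"
      unfolding yy yy' \<rho>'_def \<rho>_def using Rpos[of t] by (simp add: field_simps)
    moreover have "c t \<bullet> c' t = \<rho> t * (\<rho> t * (y t \<bullet> y' t) + \<rho>' t * (y t \<bullet> y t))"
      by (simp add: c_def c'_def inner_add_right algebra_simps)
    ultimately show ?thesis
      by simp
  qed
  \<comment> \<open>Since \<open>c' t\<close> is tangent to the sphere, \<open>g\<close> may be
    replaced by its tangential part; the term with \<open>\<rho>'\<close> then drops out, as the
    normal is orthogonal to \<open>c t\<close>.\<close>
  have slope: "g (c t) \<bullet> c' t = norm (sph_grad g (c t)) * \<rho> t * (sph_normal g (c t) \<bullet> y' t)" for t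
  proof -
    have 1: "g (c t) \<bullet> c' t = sph_grad g (c t) \<bullet> c' t"
      by (simp add: sph_grad_def inner_diff_left cc')
    have "sph_normal g (c t) \<bullet> (\<rho> t *\<^sub>R y t) = 0"
      using sph_normal_orthogonal[OF c_unit[of t], of g] by (simp add: c_def)
    moreover have "\<rho> t \<noteq> 0"
      using Rpos[of t] by (simp add: \<rho>_def)
    ultimately have "sph_normal g (c t) \<bullet> c' t = \<rho> t * (sph_normal g (c t) \<bullet> y' t)"
      by (simp add: c'_def inner_add_right)
    then show ?thesis
      unfolding 1 by (subst sph_grad_eq_normal) simp
  qed
  have c0: "c 0 = p" "c' 0 = v"
    by (simp_all add: c_def c'_def y_def y'_def \<rho>_def \<rho>'_def R_def)
  define h where "h t = \<sigma> * (sph_normal g (c t) \<bullet> y' t)" for t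
  have "(h has_real_derivative \<sigma> * (D v \<bullet> v + 2 * k)) (at 0)"
  proof -
    have "(c has_derivative (\<lambda>s. s *\<^sub>R v)) (at 0)"
      using dc[of 0] by (simp add: c0 has_vector_derivative_def)
    then have "((\<lambda>t. sph_normal g (c t)) has_derivative (\<lambda>s. D (s *\<^sub>R v))) (at 0)"
      using has_derivative_compose[of c _ 0 UNIV "sph_normal g" D] dN by (simp add: c0)
    moreover have "linear D"
      using dN has_derivative_linear by blast
    ultimately have "((\<lambda>t. sph_normal g (c t)) has_vector_derivative D v) (at 0)"
      by (simp add: has_vector_derivative_def linear_cmul)
    moreover have "(y' has_vector_derivative (2 * k) *\<^sub>R \<nu>) (at 0)"
      unfolding y'_def by (auto intro!: derivative_eq_intros)
    ultimately have "((\<lambda>t. sph_normal g (c t) \<bullet> y' t) has_vector_derivative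
        sph_normal g (c 0) \<bullet> ((2 * k) *\<^sub>R \<nu>) + D v \<bullet> y' 0) (at 0)"
      by (rule bounded_bilinear.has_vector_derivative[OF bounded_bilinear_inner])
    then have "((\<lambda>t. sph_normal g (c t) \<bullet> y' t) has_real_derivative D v \<bullet> v + 2 * k) (at 0)"
      using pp(2) by (simp add: c0 y'_def \<nu>_def has_real_derivative_iff_has_vector_derivative add.commute)
    then show ?thesis
      unfolding h_def by (rule DERIV_cmult)
  qed
  then obtain d1 where d1: "d1 > 0" "\<And>t. 0 < t \<Longrightarrow> t < d1 \<Longrightarrow> h 0 < h t"
    using DERIV_pos_inc_right[of h _ 0] sign by auto
  have h0: "h 0 = 0"
    using comm by (simp add: h_def c0 y'_def \<nu>_def)
  have "isCont c 0"
    using dc has_vector_derivative_continuous by blast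
  then have "\<forall>\<^sub>F t in at 0. c t \<in> U"
    using U topological_tendstoD[of c p "at 0" U] c0(1) by (simp add: isCont_def)
  then obtain d2 where d2: "d2 > 0" "\<And>t. t \<noteq> 0 \<Longrightarrow> \<bar>t\<bar> < d2 \<Longrightarrow> c t \<in> U"
    unfolding eventually_at by (auto simp: dist_real_def)
  have inU: "c t \<in> U" if "\<bar>t\<bar> < d2" for t
    using d2(2)[of t] that U(2) c0(1) by (cases "t = 0") auto
  have dFc: "((\<lambda>t. \<sigma> * F (c t)) has_real_derivative \<sigma> * (g (c t) \<bullet> c' t)) (at t)" if "\<bar>t\<bar> < d2" for t
  proof -
    have "((\<lambda>t. F (c t)) has_derivative (\<lambda>s. g (c t) \<bullet> (s *\<^sub>R c' t))) (at t)"
      by (rule has_derivative_compose[OF dc[unfolded has_vector_derivative_def] dF[OF inU[OF that]]])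
    then have "((\<lambda>t. F (c t)) has_real_derivative g (c t) \<bullet> c' t) (at t)"
      by (simp add: has_field_derivative_def mult_commute_abs)
    then show ?thesis
      by (rule DERIV_cmult)
  qed
  have "\<sigma> * F (c t) > 0" if t: "0 < t" "t < min d1 d2" for t
  proof -
    have "\<sigma> * F (c 0) < \<sigma> * F (c t)"
    proof (rule DERIV_pos_imp_increasing_open[OF t(1)])
      show "\<exists>b. ((\<lambda>t. \<sigma> * F (c t)) has_real_derivative b) (at x) \<and> b > 0" if x: "0 < x" "x < t" for x
      proof -
        have hx: "h x > 0"
          using d1(2)[of x] x t h0 by auto
        \<comment> \<open>Positivity of \<open>h\<close> itself rules out a vanishing tangential
          gradient at \<open>c x\<close>.\<close>
        then have "sph_normal g (c x) \<noteq> 0"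
          by (auto simp: h_def)
        then have "norm (sph_grad g (c x)) > 0"
          by (auto simp: sph_normal_def)
        then have "norm (sph_grad g (c x)) * \<rho> x * h x > 0"
          using hx Rpos[of x] by (simp add: \<rho>_def)
        then have "\<sigma> * (g (c x) \<bullet> c' x) > 0"
          by (simp add: slope h_def mult_ac)
        then show ?thesis
          using dFc[of x] x t by auto
      qed
      show "continuous_on {0..t} (\<lambda>t. \<sigma> * F (c t))"
        using t by (intro continuous_at_imp_continuous_on ballI DERIV_isCont[OF dFc]) auto
    qed
    then show ?thesis
      using Fp c0 by simp
  qed
  then have "\<forall>\<^sub>F t in at_right 0. \<sigma> * F (c t) > 0"
    using d1(1) d2(1) by (intro eventually_at_rightI[of 0 "min d1 d2"]) auto
  then show ?thesis
    unfolding c_sgn[symmetric] y_def .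
qed

text \<open>Turns solutions within every tolerance into one function with a limit.
  \<open>\<kappa> t\<close> is chosen among the admissible values so that its distance to
  \<open>k0\<close> is within \<open>t\<close> of the infimum; the slack \<open>t\<close> avoids
  asking for a minimiser and vanishes in the limit.\<close>

lemma approximate_selection:
  fixes k0 :: real
  assumes "\<And>\<delta>. \<delta> > 0 \<Longrightarrow> \<forall>\<^sub>F t in at_right (0::real). \<exists>k. \<bar>k - k0\<bar> \<le> \<delta> \<and> P t k"
  obtains \<kappa> where "(\<kappa> \<longlongrightarrow> k0) (at_right 0)" "\<forall>\<^sub>F t in at_right 0. P t (\<kappa> t)"
proof -
  define good where "good t k \<longleftrightarrow> P t k \<and> (\<forall>k'. P t k' \<longrightarrow> \<bar>k - k0\<bar> \<le> \<bar>k' - k0\<bar> + t)" for t k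
  define \<kappa> where "\<kappa> t = (SOME k. good t k)" for t
  have ex: "good t (\<kappa> t)" if t: "t > 0" and "P t k" for t k
  proof -
    define S where "S = {\<bar>k - k0\<bar> | k. P t k}"
    have S: "S \<noteq> {}" "bdd_below S"
      using that by (auto simp: S_def intro!: bdd_belowI[of _ 0])
    then obtain s where "s \<in> S" "s < Inf S + t"
      using cInf_lessD[of S "Inf S + t"] t by auto
    then obtain k where k: "P t k" "\<bar>k - k0\<bar> < Inf S + t"
      by (auto simp: S_def)
    have "Inf S \<le> \<bar>k' - k0\<bar>" if "P t k'" for k'
      using S that by (intro cInf_lower) (auto simp: S_def)
    then have "good t k"
      using k unfolding good_def by fastforce
    then show ?thesis
      unfolding \<kappa>_def by (rule someI)
  qed
  have pos: "\<forall>\<^sub>F t in at_right (0::real). t > 0"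
    by (rule eventually_at_right_less)
  show thesis
  proof
    show "\<forall>\<^sub>F t in at_right 0. P t (\<kappa> t)"
      using assms[OF zero_less_one] pos by eventually_elim (use ex in \<open>auto simp: good_def\<close>)
    show "(\<kappa> \<longlongrightarrow> k0) (at_right 0)"
    proof (rule tendstoI)
      fix e :: real
      assume e: "e > 0"
      have "\<forall>\<^sub>F t in at_right (0::real). t < e / 2"
        using e by (intro eventually_at_rightI[of 0 "e / 2"]) auto
      then show "\<forall>\<^sub>F t in at_right 0. dist (\<kappa> t) k0 < e"
        using assms[OF half_gt_zero[OF e]] pos
      proof (eventually_elim)
        case (elim t)
        then obtain k where k: "\<bar>k - k0\<bar> \<le> e / 2" "P t k"
          by blast
        then have "\<bar>\<kappa> t - k0\<bar> \<le> \<bar>k - k0\<bar> + t"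
          using ex[OF elim(3)] by (auto simp: good_def)
        then show ?case
          using k elim by (simp add: dist_real_def)
      qed
    qed
  qed
qed

text \<open>Moving \<open>p + t v\<close> by \<open>t\<^sup>2 k \<nu>\<close> and projecting to the sphere gives a point where the defining function
  has the sign of \<open>k + D v \<bullet> v / 2\<close>. The intermediate value theorem in \<open>k\<close> then yields a point of the
  hypersurface, which makes an implicit function theorem unnecessary.\<close>

lemma hypersurface_curve:
  fixes F :: "real^'n \<Rightarrow> real" and g :: "real^'n \<Rightarrow> real^'n" and p v :: "real^'n"
  defines "\<nu> \<equiv> sph_normal g p"
  assumes U: "open U" "p \<in> U"
    and dF: "\<And>x. x \<in> U \<Longrightarrow> (F has_derivative (\<lambda>h. g x \<bullet> h)) (at x)"
    and \<Sigma>: "\<Sigma> \<inter> U = {x \<in> U \<inter> sphere 0 1. F x = 0}"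
    and Fp: "F p = 0" and p: "norm p = 1"
    and dN: "(sph_normal g has_derivative D) (at p)"
    and v: "v \<bullet> p = 0" "v \<bullet> \<nu> = 0" and \<nu>: "norm \<nu> = 1"
  obtains \<gamma> where "\<forall>\<^sub>F t in at_right 0. \<gamma> t \<in> \<Sigma>"
    "((\<lambda>t. (1 / t\<^sup>2) *\<^sub>R (\<gamma> t - p - t *\<^sub>R v)) \<longlongrightarrow> (- (D v \<bullet> v) / 2) *\<^sub>R \<nu> - (v \<bullet> v / 2) *\<^sub>R p)
      (at_right 0)"
proof -
  define Y where "Y t k = p + t *\<^sub>R v + (t\<^sup>2 * k) *\<^sub>R \<nu>" for t k
  define k0 where "k0 = - (D v \<bullet> v) / 2"
  have \<nu>p: "\<nu> \<bullet> p = 0"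
    unfolding \<nu>_def using p by (rule sph_normal_orthogonal)
  have comm: "p \<bullet> v = 0" "p \<bullet> \<nu> = 0" "\<nu> \<bullet> v = 0"
    using v \<nu>p by (simp_all add: inner_commute)
  have pp: "p \<bullet> p = 1" "\<nu> \<bullet> \<nu> = 1"
    using p \<nu> by (simp_all add: norm_eq_1)
  have YY: "(norm (Y t k))\<^sup>2 = 1 + t\<^sup>2 * (v \<bullet> v + t\<^sup>2 * k\<^sup>2)" for t k
    using v \<nu>p comm pp unfolding power2_norm_eq_inner
    by (simp add: Y_def inner_add_left inner_add_right power2_eq_square algebra_simps)
  have Y_nz: "norm (Y t k) > 0" for t k
  proof -
    have "(norm (Y t k))\<^sup>2 > 0"
      unfolding YY by (intro add_pos_nonneg mult_nonneg_nonneg add_nonneg_nonneg) auto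
    then show ?thesis
      by (simp add: zero_less_power2)
  qed
  obtain \<eta> where \<eta>: "\<eta> > 0" "ball p \<eta> \<subseteq> U"
    using U openE by blast
  have sel: "\<forall>\<^sub>F t in at_right 0. \<exists>k. \<bar>k - k0\<bar> \<le> \<delta> \<and> sgn (Y t k) \<in> \<Sigma>" if \<delta>: "\<delta> > 0" for \<delta>
  proof -
    have "\<forall>\<^sub>F t in at_right 0. 1 * F (sgn (p + t *\<^sub>R v + (t\<^sup>2 * (k0 + \<delta>)) *\<^sub>R sph_normal g p)) > 0"
      using v \<nu> \<delta> unfolding \<nu>_def
      by (intro level_function_sign[OF U dF Fp p dN]) (auto simp: k0_def)
    moreover have "\<forall>\<^sub>F t in at_right 0. (-1) * F (sgn (p + t *\<^sub>R v + (t\<^sup>2 * (k0 - \<delta>)) *\<^sub>R sph_normal g p)) > 0"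
      using v \<nu> \<delta> unfolding \<nu>_def
      by (intro level_function_sign[OF U dF Fp p dN]) (auto simp: k0_def)
    moreover have "((\<lambda>t::real. \<bar>t\<bar> * norm v + t\<^sup>2 * (\<bar>k0\<bar> + \<delta>)) \<longlongrightarrow> \<bar>0\<bar> * norm v + 0\<^sup>2 * (\<bar>k0\<bar> + \<delta>)) (at_right 0)"
      by (intro tendsto_intros)
    \<comment> \<open>Half the radius suffices: since \<open>norm p = 1\<close>, projecting to the
      sphere moves \<open>Y t k\<close> by at most its distance from \<open>p\<close>, which costs
      the other half.\<close>
    then have "\<forall>\<^sub>F t::real in at_right 0. \<bar>t\<bar> * norm v + t\<^sup>2 * (\<bar>k0\<bar> + \<delta>) < \<eta> / 2"
      using \<eta>(1) by (intro order_tendstoD) auto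
    ultimately show ?thesis
    proof eventually_elim
      case (elim t)
      have inU: "sgn (Y t k) \<in> U" if k: "k \<in> {k0 - \<delta>..k0 + \<delta>}" for k
      proof -
        have "norm (Y t k - p) \<le> norm (t *\<^sub>R v) + norm ((t\<^sup>2 * k) *\<^sub>R \<nu>)"
          unfolding Y_def using norm_triangle_ineq[of "t *\<^sub>R v" "(t\<^sup>2 * k) *\<^sub>R \<nu>"] by simp
        also have "\<dots> \<le> \<bar>t\<bar> * norm v + t\<^sup>2 * (\<bar>k0\<bar> + \<delta>)"
          using \<nu> k by (auto simp: abs_mult intro!: mult_left_mono)
        finally have Yp: "norm (Y t k - p) < \<eta> / 2"
          using elim by linarith
        have "sgn (Y t k) - Y t k = (1 / norm (Y t k) - 1) *\<^sub>R Y t k"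
          by (simp add: sgn_div_norm scaleR_diff_left divide_inverse)
        then have "norm (sgn (Y t k) - Y t k) = \<bar>(1 / norm (Y t k) - 1) * norm (Y t k)\<bar>"
          by (simp add: abs_mult)
        also have "\<dots> = \<bar>norm p - norm (Y t k)\<bar>"
          using Y_nz[of t k] p by (simp add: left_diff_distrib)
        also have "\<dots> \<le> norm (Y t k - p)"
          using norm_triangle_ineq3[of p "Y t k"] by (simp add: norm_minus_commute)
        finally have "norm (sgn (Y t k) - p) < \<eta>"
          using Yp norm_triangle_ineq[of "sgn (Y t k) - Y t k" "Y t k - p"] by simp
        then show ?thesis
          using \<eta>(2) by (auto simp: dist_norm norm_minus_commute)
      qed
      have "continuous_on {k0 - \<delta>..k0 + \<delta>} (\<lambda>k. F (sgn (Y t k)))"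
      proof (rule continuous_on_compose2[of U F])
        show "continuous_on U F"
          using dF has_derivative_continuous by (intro continuous_at_imp_continuous_on) blast
        show "continuous_on {k0 - \<delta>..k0 + \<delta>} (\<lambda>k. sgn (Y t k))"
          unfolding sgn_div_norm using Y_nz[of t]
          by (auto intro!: continuous_intros simp: Y_def)
      qed (use inU in auto)
      moreover have "F (sgn (Y t (k0 - \<delta>))) \<le> 0" "0 \<le> F (sgn (Y t (k0 + \<delta>)))"
        using elim by (simp_all add: Y_def \<nu>_def)
      ultimately obtain k where k: "k0 - \<delta> \<le> k" "k \<le> k0 + \<delta>" "F (sgn (Y t k)) = 0"
        using IVT'[of "\<lambda>k. F (sgn (Y t k))" "k0 - \<delta>" 0 "k0 + \<delta>"] \<delta> by auto
      then have "sgn (Y t k) \<in> \<Sigma> \<inter> U"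
        unfolding \<Sigma> using inU[of k] Y_nz[of t k] by (auto simp: norm_sgn)
      then show ?case
        using k by (intro exI[of _ k]) auto
    qed
  qed
  obtain \<kappa> where \<kappa>: "(\<kappa> \<longlongrightarrow> k0) (at_right 0)" "\<forall>\<^sub>F t in at_right 0. sgn (Y t (\<kappa> t)) \<in> \<Sigma>"
    using approximate_selection[where P = "\<lambda>t k. sgn (Y t k) \<in> \<Sigma>", OF sel] by blast
  \<comment> \<open>The second-order quotient rewritten without division by
    \<open>t\<^sup>2\<close>, using \<open>1 / n - 1 = (1 - n\<^sup>2) / (n * (1 + n))\<close>. As
    the norm tends to 1, the denominator tends to 2, whence the coefficient
    \<open>v \<bullet> v / 2\<close>.\<close>
  define X where "X t k = k *\<^sub>R \<nu> - ((v \<bullet> v + t\<^sup>2 * k\<^sup>2) / (norm (Y t k) * (1 + norm (Y t k)))) *\<^sub>R Y t k" for t k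
  have X: "(1 / t\<^sup>2) *\<^sub>R (sgn (Y t k) - p - t *\<^sub>R v) = X t k" if t: "t > 0" for t k
  proof -
    define n where "n = norm (Y t k)"
    have n: "n > 0" "n\<^sup>2 = 1 + t\<^sup>2 * (v \<bullet> v + t\<^sup>2 * k\<^sup>2)"
      using Y_nz[of t k] YY[of t k] by (simp_all add: n_def)
    have "1 / n - 1 = (1 - n\<^sup>2) / (n * (1 + n))"
      using n(1) by (simp add: divide_simps) (simp add: algebra_simps power2_eq_square)
    also have "\<dots> = - (t\<^sup>2 * ((v \<bullet> v + t\<^sup>2 * k\<^sup>2) / (n * (1 + n))))"
      unfolding n(2) by simp
    finally have "(1 / t\<^sup>2) * (1 / n - 1) = - ((v \<bullet> v + t\<^sup>2 * k\<^sup>2) / (n * (1 + n)))"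
      using t by simp
    moreover have "sgn (Y t k) - p - t *\<^sub>R v = (1 / n - 1) *\<^sub>R Y t k + (t\<^sup>2 * k) *\<^sub>R \<nu>"
      by (simp add: Y_def n_def sgn_div_norm scaleR_diff_left divide_inverse)
    then have "(1 / t\<^sup>2) *\<^sub>R (sgn (Y t k) - p - t *\<^sub>R v)
        = ((1 / t\<^sup>2) * (1 / n - 1)) *\<^sub>R Y t k + k *\<^sub>R \<nu>"
      using t by (simp add: scaleR_add_right)
    ultimately show ?thesis
      by (simp add: X_def n_def)
  qed
  have Ylim: "((\<lambda>t. Y t (\<kappa> t)) \<longlongrightarrow> p + 0 *\<^sub>R v + (0\<^sup>2 * k0) *\<^sub>R \<nu>) (at_right 0)"
    unfolding Y_def by (intro tendsto_intros \<kappa>)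
  then have "((\<lambda>t. X t (\<kappa> t)) \<longlongrightarrow> k0 *\<^sub>R \<nu> - ((v \<bullet> v + 0\<^sup>2 * k0\<^sup>2) / (norm p * (1 + norm p))) *\<^sub>R p) (at_right 0)"
    unfolding X_def using p by (intro tendsto_intros \<kappa>) auto
  then have "((\<lambda>t. X t (\<kappa> t)) \<longlongrightarrow> k0 *\<^sub>R \<nu> - (v \<bullet> v / 2) *\<^sub>R p) (at_right 0)"
    using p by simp
  moreover have "\<forall>\<^sub>F t in at_right 0. X t (\<kappa> t) = (1 / t\<^sup>2) *\<^sub>R (sgn (Y t (\<kappa> t)) - p - t *\<^sub>R v)"
    using eventually_at_right_less[of 0] by eventually_elim (simp add: X)
  ultimately have "((\<lambda>t. (1 / t\<^sup>2) *\<^sub>R (sgn (Y t (\<kappa> t)) - p - t *\<^sub>R v)) \<longlongrightarrow>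
      k0 *\<^sub>R \<nu> - (v \<bullet> v / 2) *\<^sub>R p) (at_right 0)"
    by (rule Lim_transform_eventually)
  then show thesis
    using that \<kappa>(2) by (simp add: k0_def)
qed

text \<open>Together with nonemptiness, compactness and lying in the sphere, this is all that the
  later arguments use of a minimal hypersurface. \<open>A v\<close> is
  \<open>- (D v \<bullet> v) / 2\<close>, a multiple of the second fundamental form, so its
  vanishing sum is minimality; the term along \<open>p\<close> comes from staying on the
  sphere.\<close>

lemma minimal_hypersurface_curves:
  fixes p :: "real^'n"
  assumes \<Sigma>: "closed_embedded_minimal_hypersurface \<Sigma>" and p\<Sigma>: "p \<in> \<Sigma>"
  obtains \<nu> A where "norm \<nu> = 1" "\<nu> \<bullet> p = 0"
    "\<And>E. pairwise orthogonal E \<Longrightarrow> (\<And>e. e \<in> E \<Longrightarrow> norm e = 1 \<and> e \<bullet> p = 0 \<and> e \<bullet> \<nu> = 0) \<Longrightarrow>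
      finite E \<Longrightarrow> card E + 2 = CARD('n) \<Longrightarrow> (\<Sum>e\<in>E. A e) = (0::real)"
    "\<And>v. v \<bullet> p = 0 \<Longrightarrow> v \<bullet> \<nu> = 0 \<Longrightarrow> \<exists>\<gamma>. (\<forall>\<^sub>F t in at_right 0. \<gamma> t \<in> \<Sigma>) \<and>
      ((\<lambda>t. (1 / t\<^sup>2) *\<^sub>R (\<gamma> t - p - t *\<^sub>R v)) \<longlongrightarrow> A v *\<^sub>R \<nu> - (v \<bullet> v / 2) *\<^sub>R p) (at_right 0)"
proof -
  obtain U F g where U: "p \<in> U" "C2_with_grad U F g" and \<Sigma>U: "\<Sigma> \<inter> U = {x \<in> U \<inter> sphere 0 1. F x = 0}"
    and reg: "\<forall>x\<in>\<Sigma> \<inter> U. sph_grad g x \<noteq> 0"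
    and min: "\<forall>x\<in>\<Sigma> \<inter> U. \<exists>D. (sph_normal g has_derivative D) (at x) \<and> sph_div D x = 0"
    using \<Sigma> p\<Sigma> unfolding closed_embedded_minimal_hypersurface_def by meson
  have oU: "open U" and dF: "\<And>x. x \<in> U \<Longrightarrow> (F has_derivative (\<lambda>h. g x \<bullet> h)) (at x)"
    using U(2) by (auto simp: C2_with_grad_def)
  have p: "p \<in> \<Sigma> \<inter> U" "norm p = 1" "F p = 0"
    using p\<Sigma> U(1) \<Sigma>U by auto
  obtain D where D: "(sph_normal g has_derivative D) (at p)" "sph_div D p = 0"
    using min p(1) by blast
  define \<nu> where "\<nu> = sph_normal g p"
  have \<nu>: "norm \<nu> = 1" "\<nu> \<bullet> p = 0"
    using reg p sph_normal_orthogonal[OF p(2), of g] by (simp_all add: \<nu>_def sph_normal_def)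
  \<comment> \<open>The squared length of the normal field is maximal at \<open>p\<close>, so its
    derivative vanishes there; in direction \<open>\<nu>\<close> this gives
    \<open>D \<nu> \<bullet> \<nu> = 0\<close>.\<close>
  have "((\<lambda>x. sph_normal g x \<bullet> sph_normal g x) has_derivative (\<lambda>h. \<nu> \<bullet> D h + D h \<bullet> \<nu>)) (at p)"
    unfolding \<nu>_def by (intro has_derivative_inner D)
  then have "(\<lambda>h. \<nu> \<bullet> D h + D h \<bullet> \<nu>) = (\<lambda>h. 0)"
  proof (rule differential_zero_maxmin[OF UNIV_I open_UNIV])
    show "(\<forall>x\<in>UNIV. sph_normal g x \<bullet> sph_normal g x \<le> sph_normal g p \<bullet> sph_normal g p) \<or>
      (\<forall>x\<in>UNIV. sph_normal g p \<bullet> sph_normal g p \<le> sph_normal g x \<bullet> sph_normal g x)"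
      using \<nu>(1) norm_sph_normal_le[of g] unfolding \<nu>_def
      by (simp add: dot_square_norm power_le_one)
  qed
  then have "\<nu> \<bullet> D \<nu> + D \<nu> \<bullet> \<nu> = 0"
    by meson
  then have D\<nu>: "D \<nu> \<bullet> \<nu> = 0"
    by (simp add: inner_commute)
  show thesis
  proof
    show "norm \<nu> = 1" "\<nu> \<bullet> p = 0"
      by (fact \<nu>)+
    show "(\<Sum>e\<in>E. - (D e \<bullet> e) / 2) = 0"
      if E: "pairwise orthogonal E" "\<And>e. e \<in> E \<Longrightarrow> norm e = 1 \<and> e \<bullet> p = 0 \<and> e \<bullet> \<nu> = 0"
        "finite E" "card E + 2 = CARD('n)" for E
    proof -
      have notin: "p \<notin> E" "\<nu> \<notin> E" "p \<noteq> \<nu>"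
        using E(2) p(2) \<nu> by (force simp: norm_eq_1)+
      \<comment> \<open>In this frame the contribution of \<open>p\<close> is what
        \<open>sph_div\<close> subtracts and that of \<open>\<nu>\<close> is zero, so only the sum
        over \<open>E\<close> remains.\<close>
      have "(\<Sum>x\<in>insert p (insert \<nu> E). D x \<bullet> x) = (\<Sum>i\<in>UNIV. D (axis i 1) $ i)"
      proof (rule orthonormal_trace)
        show "linear D"
          using D(1) has_derivative_linear by blast
        show "pairwise orthogonal (insert p (insert \<nu> E))"
          using E(1,2) \<nu>(2) by (auto simp: pairwise_insert orthogonal_def inner_commute)
        show "card (insert p (insert \<nu> E)) = CARD('n)"
          using E(3,4) notin by simp
      qed (use E(2) p(2) \<nu>(1) in auto)
      then have "(\<Sum>e\<in>E. D e \<bullet> e) = 0"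
        using D(2) D\<nu> E(3) notin by (simp add: sph_div_def)
      then show ?thesis
        by (simp add: sum_negf flip: sum_divide_distrib)
    qed
    show "\<exists>\<gamma>. (\<forall>\<^sub>F t in at_right 0. \<gamma> t \<in> \<Sigma>) \<and>
      ((\<lambda>t. (1 / t\<^sup>2) *\<^sub>R (\<gamma> t - p - t *\<^sub>R v)) \<longlongrightarrow> (- (D v \<bullet> v) / 2) *\<^sub>R \<nu> - (v \<bullet> v / 2) *\<^sub>R p) (at_right 0)"
      if v: "v \<bullet> p = 0" "v \<bullet> \<nu> = 0" for v
    proof -
      obtain \<gamma> where "\<forall>\<^sub>F t in at_right 0. \<gamma> t \<in> \<Sigma>"
        "((\<lambda>t. (1 / t\<^sup>2) *\<^sub>R (\<gamma> t - p - t *\<^sub>R v)) \<longlongrightarrow>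
          (- (D v \<bullet> v) / 2) *\<^sub>R sph_normal g p - (v \<bullet> v / 2) *\<^sub>R p) (at_right 0)"
        using hypersurface_curve[OF oU U(1) dF \<Sigma>U p(3,2) D(1), of v] v \<nu>(1) unfolding \<nu>_def by blast
      then show ?thesis
        unfolding \<nu>_def by blast
    qed
  qed
qed

section \<open>Second variation of a bilinear form at a maximum\<close>

lemma bilinear_second_variation:
  fixes f :: "'a::real_normed_vector \<Rightarrow> 'b::real_normed_vector \<Rightarrow> real"
  assumes f: "bounded_bilinear f"
    and \<gamma>: "((\<lambda>t. (1 / t\<^sup>2) *\<^sub>R (\<gamma> t - p - t *\<^sub>R v)) \<longlongrightarrow> \<xi>) (at_right 0)"
    and \<delta>: "((\<lambda>t. (1 / t\<^sup>2) *\<^sub>R (\<delta> t - q - t *\<^sub>R w)) \<longlongrightarrow> \<zeta>) (at_right 0)"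
    and le: "\<forall>\<^sub>F t in at_right (0::real). f (\<gamma> t) (\<delta> t) \<le> f p q"
  shows "f v q + f p w \<le> 0"
    and "f v q + f p w = 0 \<Longrightarrow> f \<xi> q + f p \<zeta> + f v w \<le> 0"
proof -
  interpret bounded_bilinear f by (fact f)
  define X where "X t = (1 / t\<^sup>2) *\<^sub>R (\<gamma> t - p - t *\<^sub>R v)" for t :: real
  define Y where "Y t = (1 / t\<^sup>2) *\<^sub>R (\<delta> t - q - t *\<^sub>R w)" for t :: real
  define L where "L = f v q + f p w"
  \<comment> \<open>\<open>X\<close> and \<open>Y\<close> are the second-order remainders, so
    \<open>f (\<gamma> t) (\<delta> t) - f p q = t * (L + t * Q t)\<close>. Dividing by
    \<open>t > 0\<close> gives the sign of \<open>L\<close> in the limit, and if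
    \<open>L = 0\<close> a second division gives that of \<open>Q\<close>. As \<open>t\<close> is
    only positive, the first variation appears as an inequality.\<close>
  define Q where "Q t = f (X t) q + f p (Y t) + f v w + t * (f v (Y t) + f (X t) w) + t\<^sup>2 * f (X t) (Y t)" for t
  have X: "(X \<longlongrightarrow> \<xi>) (at_right 0)" and Y: "(Y \<longlongrightarrow> \<zeta>) (at_right 0)"
    using \<gamma> \<delta> by (simp_all add: X_def[abs_def] Y_def[abs_def])
  have "(Q \<longlongrightarrow> f \<xi> q + f p \<zeta> + f v w + 0 * (f v \<zeta> + f \<xi> w) + 0\<^sup>2 * f \<xi> \<zeta>) (at_right 0)"
    unfolding Q_def by (intro tendsto_intros tendsto X Y)
  then have Q: "(Q \<longlongrightarrow> f \<xi> q + f p \<zeta> + f v w) (at_right 0)"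
    by simp
  have ev: "\<forall>\<^sub>F t in at_right 0. t > 0 \<and> L + t * Q t \<le> 0"
    using le eventually_at_right_less[of 0]
  proof eventually_elim
    case (elim t)
    have "\<gamma> t = p + t *\<^sub>R v + t\<^sup>2 *\<^sub>R X t" "\<delta> t = q + t *\<^sub>R w + t\<^sup>2 *\<^sub>R Y t"
      using elim by (simp_all add: X_def Y_def)
    then have "f (\<gamma> t) (\<delta> t) = f p q + t * (L + t * Q t)"
      by (simp add: add_left add_right scaleR_left scaleR_right L_def Q_def algebra_simps power2_eq_square)
    then have "t * (L + t * Q t) \<le> 0"
      using elim by simp
    then show ?case
      using elim by (simp add: mult_le_0_iff)
  qed
  have "((\<lambda>t. L + t * Q t) \<longlongrightarrow> L + 0 * (f \<xi> q + f p \<zeta> + f v w)) (at_right 0)"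
    by (intro tendsto_intros Q)
  then have "L + 0 * (f \<xi> q + f p \<zeta> + f v w) \<le> 0"
    by (rule tendsto_upperbound) (use ev in \<open>auto elim: eventually_mono\<close>)
  then show "f v q + f p w \<le> 0"
    by (simp add: L_def)
  show "f \<xi> q + f p \<zeta> + f v w \<le> 0" if "f v q + f p w = 0"
  proof -
    have "\<forall>\<^sub>F t in at_right 0. Q t \<le> 0"
      using ev by eventually_elim (use that in \<open>auto simp: L_def mult_le_0_iff\<close>)
    then show ?thesis
      by (intro tendsto_upperbound[OF Q]) auto
  qed
qed

lemma tendsto_base_point:
  fixes \<gamma> :: "real \<Rightarrow> 'a::real_normed_vector"
  assumes "((\<lambda>t. (1 / t\<^sup>2) *\<^sub>R (\<gamma> t - p - t *\<^sub>R v)) \<longlongrightarrow> \<xi>) (at_right 0)"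
  shows "(\<gamma> \<longlongrightarrow> p) (at_right 0)"
proof -
  have "((\<lambda>t. p + t *\<^sub>R v + t\<^sup>2 *\<^sub>R ((1 / t\<^sup>2) *\<^sub>R (\<gamma> t - p - t *\<^sub>R v))) \<longlongrightarrow>
      p + 0 *\<^sub>R v + 0\<^sup>2 *\<^sub>R \<xi>) (at_right 0)"
    by (intro tendsto_intros assms)
  moreover have "\<forall>\<^sub>F t in at_right 0. p + t *\<^sub>R v + t\<^sup>2 *\<^sub>R ((1 / t\<^sup>2) *\<^sub>R (\<gamma> t - p - t *\<^sub>R v)) = \<gamma> t"
    using eventually_at_right_less[of 0] by eventually_elim simp
  ultimately show ?thesis
    by (auto dest: Lim_transform_eventually)
qed

text \<open>The component \<open>v\<close> of \<open>b\<close> orthogonal to \<open>p\<close> and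
  \<open>\<nu>\<close> is itself an admissible test vector, and
  \<open>v \<bullet> v = v \<bullet> b \<le> 0\<close> kills it. This converts criticality into a
  statement about the normal plane.\<close>

lemma normal_plane_decomposition:
  fixes p \<nu> b :: "'a::real_inner"
  assumes "norm p = 1" "norm \<nu> = 1" "\<nu> \<bullet> p = 0"
    and crit: "\<And>v. v \<bullet> p = 0 \<Longrightarrow> v \<bullet> \<nu> = 0 \<Longrightarrow> v \<bullet> b \<le> 0"
  shows "b = (b \<bullet> p) *\<^sub>R p + (b \<bullet> \<nu>) *\<^sub>R \<nu>"
proof -
  define v where "v = b - (b \<bullet> p) *\<^sub>R p - (b \<bullet> \<nu>) *\<^sub>R \<nu>"
  have v: "v \<bullet> p = 0" "v \<bullet> \<nu> = 0"
    using assms(1-3) inner_commute[of p \<nu>] by (simp_all add: v_def inner_diff_left norm_eq_1)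
  have "v \<bullet> v = v \<bullet> b"
    using v by (subst (2) v_def) (simp add: inner_diff_right)
  then have "v \<bullet> v \<le> 0"
    using crit[OF v] by simp
  then have "v = 0"
    by (metis inner_eq_zero_iff inner_ge_zero order_antisym)
  then show ?thesis
    by (simp add: v_def algebra_simps)
qed

section \<open>Consequences for a single minimal hypersurface\<close>

lemma minimal_hypersurface_subset_sphere:
  "closed_embedded_minimal_hypersurface \<Sigma> \<Longrightarrow> x \<in> \<Sigma> \<Longrightarrow> norm x = 1"
  by (auto simp: closed_embedded_minimal_hypersurface_def)

lemma minimal_hypersurface_compact: "closed_embedded_minimal_hypersurface \<Sigma> \<Longrightarrow> compact \<Sigma>"
  by (simp add: closed_embedded_minimal_hypersurface_def)

text \<open>At a maximum \<open>p\<close> of the height \<open>x \<bullet> a\<close>, the second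
  variations along a tangent frame are nonpositive. Summed, the curvature terms cancel by minimality
  and leave \<open>0 \<le> card E * (p \<bullet> a) / 2\<close>. The height is fed to the bilinear
  lemma by keeping the second argument constantly \<open>a\<close>.\<close>

lemma minimal_hypersurface_meets_closed_hemisphere:
  fixes \<Sigma> :: "(real^'n) set"
  assumes dim: "CARD('n) \<ge> 3" and \<Sigma>: "closed_embedded_minimal_hypersurface \<Sigma>"
  obtains p where "p \<in> \<Sigma>" "p \<bullet> a \<ge> 0"
proof -
  have "\<exists>p\<in>\<Sigma>. \<forall>x\<in>\<Sigma>. x \<bullet> a \<le> p \<bullet> a"
    using \<Sigma> by (intro continuous_attains_sup continuous_intros)
      (auto simp: closed_embedded_minimal_hypersurface_def)
  then obtain p where p: "p \<in> \<Sigma>" "\<And>x. x \<in> \<Sigma> \<Longrightarrow> x \<bullet> a \<le> p \<bullet> a"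
    by blast
  have np: "norm p = 1"
    using minimal_hypersurface_subset_sphere[OF \<Sigma> p(1)] .
  obtain \<nu> A where \<nu>: "norm \<nu> = 1" "\<nu> \<bullet> p = 0"
    and trace: "\<And>E. pairwise orthogonal E \<Longrightarrow> (\<And>e. e \<in> E \<Longrightarrow> norm e = 1 \<and> e \<bullet> p = 0 \<and> e \<bullet> \<nu> = 0) \<Longrightarrow>
      finite E \<Longrightarrow> card E + 2 = CARD('n) \<Longrightarrow> (\<Sum>e\<in>E. A e) = (0::real)"
    and curve: "\<And>v. v \<bullet> p = 0 \<Longrightarrow> v \<bullet> \<nu> = 0 \<Longrightarrow> \<exists>\<gamma>. (\<forall>\<^sub>F t in at_right 0. \<gamma> t \<in> \<Sigma>) \<and>
      ((\<lambda>t. (1 / t\<^sup>2) *\<^sub>R (\<gamma> t - p - t *\<^sub>R v)) \<longlongrightarrow> A v *\<^sub>R \<nu> - (v \<bullet> v / 2) *\<^sub>R p) (at_right 0)"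
    using minimal_hypersurface_curves[OF \<Sigma> p(1)] by blast
  have var: "v \<bullet> a \<le> 0 \<and> (v \<bullet> a = 0 \<longrightarrow> A v * (\<nu> \<bullet> a) - (v \<bullet> v / 2) * (p \<bullet> a) \<le> 0)"
    if v: "v \<bullet> p = 0" "v \<bullet> \<nu> = 0" for v
  proof -
    obtain \<gamma> where \<gamma>: "\<forall>\<^sub>F t in at_right 0. \<gamma> t \<in> \<Sigma>"
      "((\<lambda>t. (1 / t\<^sup>2) *\<^sub>R (\<gamma> t - p - t *\<^sub>R v)) \<longlongrightarrow> A v *\<^sub>R \<nu> - (v \<bullet> v / 2) *\<^sub>R p) (at_right 0)"
      using curve[OF v] by blast
    have le: "\<forall>\<^sub>F t in at_right 0. \<gamma> t \<bullet> a \<le> p \<bullet> a"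
      using \<gamma>(1) by eventually_elim (rule p(2))
    have const: "((\<lambda>t. (1 / t\<^sup>2) *\<^sub>R (a - a - t *\<^sub>R 0)) \<longlongrightarrow> 0) (at_right (0::real))"
      by simp
    show ?thesis
      using bilinear_second_variation[OF bounded_bilinear_inner \<gamma>(2) const le]
      by (simp add: inner_diff_left)
  qed
  have a: "a = (a \<bullet> p) *\<^sub>R p + (a \<bullet> \<nu>) *\<^sub>R \<nu>"
    using normal_plane_decomposition[OF np \<nu>] var by blast
  have "p \<noteq> \<nu>"
    using np \<nu> by (auto simp: norm_eq_1)
  then have card2: "card {p, \<nu>} = 2"
    by simp
  have "pairwise orthogonal {p, \<nu>}"
    using \<nu>(2) by (auto simp: pairwise_insert orthogonal_def inner_commute)
  then obtain E where E: "pairwise orthogonal E" "\<And>e. e \<in> E \<Longrightarrow> norm e = 1"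
    "\<And>e s. e \<in> E \<Longrightarrow> s \<in> {p, \<nu>} \<Longrightarrow> e \<bullet> s = 0" "card E + card {p, \<nu>} = CARD('n)" "finite E"
    using orthonormal_complement[of "{p, \<nu>}"] np \<nu>(1) by auto
  have "A e * (\<nu> \<bullet> a) \<le> (p \<bullet> a) / 2" if e: "e \<in> E" for e
  proof -
    have 0: "e \<bullet> p = 0" "e \<bullet> \<nu> = 0"
      using E(3)[OF e] by auto
    then have "e \<bullet> a = 0"
      by (subst a) (simp add: inner_add_right)
    then show ?thesis
      using var[OF 0] E(2)[OF e] by (simp add: norm_eq_1)
  qed
  then have "(\<Sum>e\<in>E. A e * (\<nu> \<bullet> a)) \<le> real (card E) * ((p \<bullet> a) / 2)"
    by (rule sum_bounded_above)
  moreover have "(\<Sum>e\<in>E. A e) = 0"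
    using E card2 by (intro trace) auto
  ultimately have "0 \<le> real (card E) * ((p \<bullet> a) / 2)"
    by (simp flip: sum_distrib_right)
  \<comment> \<open>\<open>dim\<close> makes \<open>card E\<close> positive, so the factor can be
    cancelled.\<close>
  then have "p \<bullet> a \<ge> 0"
    using E(4) card2 dim by (simp add: zero_le_mult_iff)
  then show thesis
    using that p(1) by blast
qed

text \<open>A one-sided hyperplane through \<open>p\<close> is critical there, so its normal
  \<open>b\<close> lies in the plane of \<open>p\<close> and the unit normal, and
  \<open>p \<bullet> b = 0\<close> removes the first part. Since \<open>\<nu>\<close> is fixed
  before \<open>b\<close>, all such hyperplanes have parallel normals.\<close>

lemma minimal_hypersurface_tangent_hyperplane:
  fixes \<Sigma> :: "(real^'n) set"
  assumes \<Sigma>: "closed_embedded_minimal_hypersurface \<Sigma>" and p: "p \<in> \<Sigma>"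
  obtains \<nu> where "\<And>b. p \<bullet> b = 0 \<Longrightarrow> (\<And>x. x \<in> \<Sigma> \<Longrightarrow> x \<bullet> b \<le> 0) \<Longrightarrow> \<exists>k. b = k *\<^sub>R \<nu>"
proof -
  have np: "norm p = 1"
    using minimal_hypersurface_subset_sphere[OF \<Sigma> p] .
  obtain \<nu> A where \<nu>: "norm \<nu> = 1" "\<nu> \<bullet> p = 0"
    and "\<And>E. pairwise orthogonal E \<Longrightarrow> (\<And>e. e \<in> E \<Longrightarrow> norm e = 1 \<and> e \<bullet> p = 0 \<and> e \<bullet> \<nu> = 0) \<Longrightarrow>
      finite E \<Longrightarrow> card E + 2 = CARD('n) \<Longrightarrow> (\<Sum>e\<in>E. A e) = (0::real)"
    and curve: "\<And>v. v \<bullet> p = 0 \<Longrightarrow> v \<bullet> \<nu> = 0 \<Longrightarrow> \<exists>\<gamma>. (\<forall>\<^sub>F t in at_right 0. \<gamma> t \<in> \<Sigma>) \<and>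
      ((\<lambda>t. (1 / t\<^sup>2) *\<^sub>R (\<gamma> t - p - t *\<^sub>R v)) \<longlongrightarrow> A v *\<^sub>R \<nu> - (v \<bullet> v / 2) *\<^sub>R p) (at_right 0)"
    using minimal_hypersurface_curves[OF \<Sigma> p] by blast
  have "\<exists>k. b = k *\<^sub>R \<nu>" if b: "p \<bullet> b = 0" "\<And>x. x \<in> \<Sigma> \<Longrightarrow> x \<bullet> b \<le> 0" for b
  proof -
    have "v \<bullet> b \<le> 0" if v: "v \<bullet> p = 0" "v \<bullet> \<nu> = 0" for v
    proof -
      obtain \<gamma> where \<gamma>: "\<forall>\<^sub>F t in at_right 0. \<gamma> t \<in> \<Sigma>"
        "((\<lambda>t. (1 / t\<^sup>2) *\<^sub>R (\<gamma> t - p - t *\<^sub>R v)) \<longlongrightarrow> A v *\<^sub>R \<nu> - (v \<bullet> v / 2) *\<^sub>R p) (at_right 0)"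
        using curve[OF v] by blast
      have le: "\<forall>\<^sub>F t in at_right 0. \<gamma> t \<bullet> b \<le> p \<bullet> b"
        using \<gamma>(1) by eventually_elim (use b in auto)
      have const: "((\<lambda>t. (1 / t\<^sup>2) *\<^sub>R (b - b - t *\<^sub>R 0)) \<longlongrightarrow> 0) (at_right (0::real))"
        by simp
      show ?thesis
        using bilinear_second_variation(1)[OF bounded_bilinear_inner \<gamma>(2) const le] by simp
    qed
    then have "b = (b \<bullet> p) *\<^sub>R p + (b \<bullet> \<nu>) *\<^sub>R \<nu>"
      by (rule normal_plane_decomposition[OF np \<nu>])
    then have "b = (b \<bullet> \<nu>) *\<^sub>R \<nu>"
      using b(1) by (simp add: inner_commute)
    then show ?thesis
      by blast
  qed
  then show thesis
    using that by blast
qed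

section \<open>Two hypersurfaces that both enter the open hemisphere\<close>

lemma minimal_hypersurfaces_meet_in_hemisphere:
  fixes \<Sigma>0 \<Sigma>1 :: "(real^'n) set"
  assumes dim: "CARD('n) \<ge> 3" and \<Sigma>0: "closed_embedded_minimal_hypersurface \<Sigma>0"
    and \<Sigma>1: "closed_embedded_minimal_hypersurface \<Sigma>1" and a: "norm a = 1"
    and x0: "x0 \<in> \<Sigma>0" "x0 \<bullet> a > 0" and y0: "y0 \<in> \<Sigma>1" "y0 \<bullet> a > 0"
  shows "\<exists>x\<in>\<Sigma>0 \<inter> \<Sigma>1. x \<bullet> a \<ge> 0"
proof (rule ccontr)
  assume disj: "\<not> ?thesis"
  define K0 where "K0 = \<Sigma>0 \<inter> {x. a \<bullet> x \<ge> 0}"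
  define K1 where "K1 = \<Sigma>1 \<inter> {x. a \<bullet> x \<ge> 0}"
  have "compact (K0 \<times> K1)"
    unfolding K0_def K1_def using minimal_hypersurface_compact \<Sigma>0 \<Sigma>1
    by (intro compact_Times compact_Int_closed closed_halfspace_ge)
  moreover have K_in: "(x0, y0) \<in> K0 \<times> K1"
    using x0 y0 by (auto simp: K0_def K1_def inner_commute)
  ultimately have K: "compact (K0 \<times> K1)" "K0 \<times> K1 \<noteq> {}"
    by auto
  have unit: "norm x = 1" "norm y = 1" if "x \<in> K0" "y \<in> K1" for x y
    using that minimal_hypersurface_subset_sphere \<Sigma>0 \<Sigma>1 by (auto simp: K0_def K1_def)
  have "\<exists>z\<in>K0 \<times> K1. \<forall>w\<in>K0 \<times> K1. fst w \<bullet> snd w \<le> fst z \<bullet> snd z"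
    using K by (intro continuous_attains_sup continuous_intros) auto
  then obtain x1 y1 where xy1: "x1 \<in> K0" "y1 \<in> K1" "\<And>x y. x \<in> K0 \<Longrightarrow> y \<in> K1 \<Longrightarrow> x \<bullet> y \<le> x1 \<bullet> y1"
    by force
  have "x1 \<noteq> y1"
    using disj xy1(1,2) by (auto simp: K0_def K1_def inner_commute)
  then have "(x1 - y1) \<bullet> (x1 - y1) > 0"
    by simp
  then have "x1 \<bullet> y1 < 1"
    using unit[OF xy1(1,2)] by (simp add: inner_diff_left inner_diff_right norm_eq_1 inner_commute)
  \<comment> \<open>A number strictly between the largest inner product and 1; the maximum with
    \<open>1 / 2\<close> secures \<open>0 \<le> m\<close>, which the adapted frames require.\<close>
  define m where "m = max ((1 + x1 \<bullet> y1) / 2) (1 / 2)"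
  have m: "m < 1" "m \<ge> 1 / 2" "x1 \<bullet> y1 < m"
    using \<open>x1 \<bullet> y1 < 1\<close> by (auto simp: m_def max_def)
  have lt_m: "x \<bullet> y < m" if "x \<in> K0" "y \<in> K1" for x y
    using xy1(3)[OF that] m(3) by linarith
  have "\<exists>z\<in>K0 \<times> K1. \<forall>w\<in>K0 \<times> K1. (fst w \<bullet> a) * (snd w \<bullet> a) / (m - fst w \<bullet> snd w)
      \<le> (fst z \<bullet> a) * (snd z \<bullet> a) / (m - fst z \<bullet> snd z)"
    using K lt_m by (intro continuous_attains_sup continuous_intros) fastforce+
  then obtain p q where p: "p \<in> K0" and q: "q \<in> K1" and
    pq_max: "\<And>x y. x \<in> K0 \<Longrightarrow> y \<in> K1 \<Longrightarrow>
      (x \<bullet> a) * (y \<bullet> a) / (m - x \<bullet> y) \<le> (p \<bullet> a) * (q \<bullet> a) / (m - p \<bullet> q)"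
    by force
  define \<rho> where "\<rho> = (p \<bullet> a) * (q \<bullet> a) / (m - p \<bullet> q)"
  \<comment> \<open>The given points in the open hemisphere make the maximal quotient positive,
    which forces \<open>p\<close> and \<open>q\<close> off the equator.\<close>
  have "0 < (x0 \<bullet> a) * (y0 \<bullet> a) / (m - x0 \<bullet> y0)"
    using x0 y0 lt_m K_in by auto
  then have \<rho>: "\<rho> > 0"
    using pq_max[of x0 y0] K_in by (auto simp: \<rho>_def)
  have pa: "p \<bullet> a > 0" and qa: "q \<bullet> a > 0"
    using \<rho> p q by (auto simp: \<rho>_def K0_def K1_def inner_commute less_le)
  define c where "c = 1 / \<rho>"
  have c: "c > 0"
    using \<rho> by (simp add: c_def)
  \<comment> \<open>This is the matrix \<open>B = I + c a a\<^sup>T\<close>.\<close>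
  define T where "T y = y + (c * (y \<bullet> a)) *\<^sub>R a" for y
  define f where "f x y = x \<bullet> T y" for x y
  have f: "f x y = x \<bullet> y + c * (x \<bullet> a) * (y \<bullet> a)" for x y
    by (simp add: f_def T_def inner_add_right)
  have f_comm: "f x y = y \<bullet> T x" for x y
    by (simp add: f T_def inner_add_right inner_commute[of x y])
  have "linear T"
    unfolding T_def by (rule linearI) (simp_all add: algebra_simps inner_add_left)
  then have bil: "bounded_bilinear f"
    unfolding f_def using bounded_bilinear.comp[OF bounded_bilinear_inner bounded_linear_ident]
    by (simp add: linear_conv_bounded_linear)
  have f_le: "f x y \<le> m" if "x \<in> K0" "y \<in> K1" for x y
  proof -
    have "(x \<bullet> a) * (y \<bullet> a) \<le> \<rho> * (m - x \<bullet> y)"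
      using pq_max[OF that] lt_m[OF that] by (simp add: \<rho>_def[symmetric] divide_le_eq)
    then show ?thesis
      using \<rho> by (simp add: f c_def field_simps)
  qed
  have fpq: "f p q = m"
    using lt_m[OF p q] pa qa by (simp add: f c_def \<rho>_def)
  have np: "norm p = 1" and nq: "norm q = 1"
    using unit p q by auto
  have p\<Sigma>: "p \<in> \<Sigma>0" and q\<Sigma>: "q \<in> \<Sigma>1"
    using p q by (auto simp: K0_def K1_def)
  obtain \<nu>0 A0 where \<nu>0: "norm \<nu>0 = 1" "\<nu>0 \<bullet> p = 0"
    and trace0: "\<And>E. pairwise orthogonal E \<Longrightarrow> (\<And>e. e \<in> E \<Longrightarrow> norm e = 1 \<and> e \<bullet> p = 0 \<and> e \<bullet> \<nu>0 = 0) \<Longrightarrow>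
      finite E \<Longrightarrow> card E + 2 = CARD('n) \<Longrightarrow> (\<Sum>e\<in>E. A0 e) = (0::real)"
    and curve0: "\<And>v. v \<bullet> p = 0 \<Longrightarrow> v \<bullet> \<nu>0 = 0 \<Longrightarrow> \<exists>\<gamma>. (\<forall>\<^sub>F t in at_right 0. \<gamma> t \<in> \<Sigma>0) \<and>
      ((\<lambda>t. (1 / t\<^sup>2) *\<^sub>R (\<gamma> t - p - t *\<^sub>R v)) \<longlongrightarrow> A0 v *\<^sub>R \<nu>0 - (v \<bullet> v / 2) *\<^sub>R p) (at_right 0)"
    using minimal_hypersurface_curves[OF \<Sigma>0 p\<Sigma>] by blast
  obtain \<nu>1 A1 where \<nu>1: "norm \<nu>1 = 1" "\<nu>1 \<bullet> q = 0"
    and trace1: "\<And>E. pairwise orthogonal E \<Longrightarrow> (\<And>e. e \<in> E \<Longrightarrow> norm e = 1 \<and> e \<bullet> q = 0 \<and> e \<bullet> \<nu>1 = 0) \<Longrightarrow>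
      finite E \<Longrightarrow> card E + 2 = CARD('n) \<Longrightarrow> (\<Sum>e\<in>E. A1 e) = (0::real)"
    and curve1: "\<And>v. v \<bullet> q = 0 \<Longrightarrow> v \<bullet> \<nu>1 = 0 \<Longrightarrow> \<exists>\<gamma>. (\<forall>\<^sub>F t in at_right 0. \<gamma> t \<in> \<Sigma>1) \<and>
      ((\<lambda>t. (1 / t\<^sup>2) *\<^sub>R (\<gamma> t - q - t *\<^sub>R v)) \<longlongrightarrow> A1 v *\<^sub>R \<nu>1 - (v \<bullet> v / 2) *\<^sub>R q) (at_right 0)"
    using minimal_hypersurface_curves[OF \<Sigma>1 q\<Sigma>] by blast
  \<comment> \<open>Comparison with the maximum is valid only on \<open>K0\<close> and
    \<open>K1\<close>; since \<open>p\<close> and \<open>q\<close> are strictly inside, the curves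
    stay there for small \<open>t\<close>.\<close>
  have stay: "\<forall>\<^sub>F t in at_right 0. \<gamma> t \<in> S \<inter> {x. a \<bullet> x \<ge> 0}"
    if "\<forall>\<^sub>F t in at_right 0. \<gamma> t \<in> S" "z \<bullet> a > 0"
      "((\<lambda>t. (1 / t\<^sup>2) *\<^sub>R (\<gamma> t - z - t *\<^sub>R v)) \<longlongrightarrow> \<xi>) (at_right 0)" for \<gamma> S z v \<xi>
  proof -
    have "((\<lambda>t. \<gamma> t \<bullet> a) \<longlongrightarrow> z \<bullet> a) (at_right 0)"
      by (intro tendsto_intros tendsto_base_point[OF that(3)])
    then have "\<forall>\<^sub>F t in at_right 0. \<gamma> t \<bullet> a > 0"
      using that(2) by (rule order_tendstoD)
    with that(1) show ?thesis
      by eventually_elim (simp add: inner_commute)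
  qed
  have var: "f v q + f p w \<le> 0 \<and> (f v q + f p w = 0 \<longrightarrow>
      A0 v * f \<nu>0 q + A1 w * f p \<nu>1 + f v w \<le> (v \<bullet> v + w \<bullet> w) / 2 * m)"
    if v: "v \<bullet> p = 0" "v \<bullet> \<nu>0 = 0" and w: "w \<bullet> q = 0" "w \<bullet> \<nu>1 = 0" for v w
  proof -
    obtain \<gamma> where \<gamma>: "\<forall>\<^sub>F t in at_right 0. \<gamma> t \<in> \<Sigma>0"
      "((\<lambda>t. (1 / t\<^sup>2) *\<^sub>R (\<gamma> t - p - t *\<^sub>R v)) \<longlongrightarrow> A0 v *\<^sub>R \<nu>0 - (v \<bullet> v / 2) *\<^sub>R p) (at_right 0)"
      using curve0[OF v] by blast
    obtain \<delta> where \<delta>: "\<forall>\<^sub>F t in at_right 0. \<delta> t \<in> \<Sigma>1"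
      "((\<lambda>t. (1 / t\<^sup>2) *\<^sub>R (\<delta> t - q - t *\<^sub>R w)) \<longlongrightarrow> A1 w *\<^sub>R \<nu>1 - (w \<bullet> w / 2) *\<^sub>R q) (at_right 0)"
      using curve1[OF w] by blast
    have "\<forall>\<^sub>F t in at_right 0. f (\<gamma> t) (\<delta> t) \<le> f p q"
      using stay[OF \<gamma>(1) pa \<gamma>(2)] stay[OF \<delta>(1) qa \<delta>(2)] unfolding K0_def[symmetric] K1_def[symmetric]
      by eventually_elim (simp add: f_le fpq)
    note var = bilinear_second_variation[OF bil \<gamma>(2) \<delta>(2) this]
    have "f (A0 v *\<^sub>R \<nu>0 - (v \<bullet> v / 2) *\<^sub>R p) q = A0 v * f \<nu>0 q - (v \<bullet> v / 2) * m"
      "f p (A1 w *\<^sub>R \<nu>1 - (w \<bullet> w / 2) *\<^sub>R q) = A1 w * f p \<nu>1 - (w \<bullet> w / 2) * m"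
      by (simp_all add: bounded_bilinear.diff_left[OF bil] bounded_bilinear.diff_right[OF bil]
          bounded_bilinear.scaleR_left[OF bil] bounded_bilinear.scaleR_right[OF bil] fpq)
    then show ?thesis
      using var by (auto simp: algebra_simps add_divide_distrib)
  qed
  \<comment> \<open>As \<open>T\<close> does not shorten vectors and \<open>m < 1\<close>, neither
    \<open>T q = m *\<^sub>R p\<close> nor \<open>T p = m *\<^sub>R q\<close> is possible. Thus both
    normal components are nonzero, and the tangent space at \<open>p\<close> is exactly the
    complement of \<open>p\<close> and \<open>T q\<close>, likewise at \<open>q\<close>.\<close>
  have T_ge: "T z \<bullet> T z \<ge> 1" if "norm z = 1" for z
  proof -
    have "T z \<bullet> T z = 1 + (2 * c + c\<^sup>2) * (z \<bullet> a)\<^sup>2"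
      using that a inner_commute[of a z]
      by (simp add: T_def inner_add_left inner_add_right norm_eq_1 algebra_simps power2_eq_square)
    then show ?thesis
      using c by simp
  qed
  have m2: "m\<^sup>2 < 1"
    using m by (simp add: abs_square_less_1)
  have "v \<bullet> T q \<le> 0" if "v \<bullet> p = 0" "v \<bullet> \<nu>0 = 0" for v
    using var[OF that, of 0] by (simp add: f)  (simp add: T_def inner_add_right algebra_simps)
  then have Tq: "T q = m *\<^sub>R p + (T q \<bullet> \<nu>0) *\<^sub>R \<nu>0"
    using normal_plane_decomposition[OF np \<nu>0, of "T q"] fpq by (simp add: f_def inner_commute)
  have "w \<bullet> T p \<le> 0" if "w \<bullet> q = 0" "w \<bullet> \<nu>1 = 0" for w
    using var[OF _ _ that, of 0] by (simp add: f) (simp add: T_def inner_add_right algebra_simps inner_commute)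
  then have Tp: "T p = m *\<^sub>R q + (T p \<bullet> \<nu>1) *\<^sub>R \<nu>1"
    using normal_plane_decomposition[OF nq \<nu>1, of "T p"] fpq by (simp add: f_comm inner_commute)
  have \<beta>0: "T q \<bullet> \<nu>0 \<noteq> 0"
  proof
    assume "T q \<bullet> \<nu>0 = 0"
    then have "T q = m *\<^sub>R p"
      using Tq by simp
    then show False
      using T_ge[OF nq] np m2 by (simp add: norm_eq_1 power2_eq_square)
  qed
  have \<beta>1: "T p \<bullet> \<nu>1 \<noteq> 0"
  proof
    assume "T p \<bullet> \<nu>1 = 0"
    then have "T p = m *\<^sub>R q"
      using Tp by simp
    then show False
      using T_ge[OF np] nq m2 by (simp add: norm_eq_1 power2_eq_square)
  qed
  have perp0: "x \<bullet> \<nu>0 = 0" if "x \<bullet> p = 0" "f x q = 0" for x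
  proof -
    have "x \<bullet> (m *\<^sub>R p + (T q \<bullet> \<nu>0) *\<^sub>R \<nu>0) = 0"
      using that(2) Tq by (simp add: f_def)
    then show ?thesis
      using that(1) \<beta>0 by (simp add: inner_add_right)
  qed
  have perp1: "x \<bullet> \<nu>1 = 0" if "x \<bullet> q = 0" "f p x = 0" for x
  proof -
    have "x \<bullet> (m *\<^sub>R q + (T p \<bullet> \<nu>1) *\<^sub>R \<nu>1) = 0"
      using that(2) Tp by (simp add: f_comm)
    then show ?thesis
      using that(1) \<beta>1 by (simp add: inner_add_right)
  qed
  have m': "m = p \<bullet> q + c * (p \<bullet> a) * (q \<bullet> a)" "0 \<le> m"
    using fpq m(2) by (simp_all add: f)
  have dim': "DIM(real^'n) \<ge> 3"
    using dim by simp
  obtain E e e' where E: "pairwise orthogonal E" "\<And>x. x \<in> E \<Longrightarrow> norm x = 1" "card E + 3 = DIM(real^'n)"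
    "finite E" "\<And>x. x \<in> E \<Longrightarrow> x \<bullet> p = 0 \<and> x \<bullet> q = 0 \<and> x \<bullet> a = 0 \<and> x \<bullet> e = 0 \<and> x \<bullet> e' = 0"
    and e: "norm e = 1" "norm e' = 1" "e \<bullet> p = 0" "e \<bullet> q + c * (e \<bullet> a) * (q \<bullet> a) = 0"
    "e' \<bullet> q = 0" "p \<bullet> e' + c * (p \<bullet> a) * (e' \<bullet> a) = 0"
    "e \<bullet> e' + c * (e \<bullet> a) * (e' \<bullet> a) \<ge> 1"
    using adapted_frames[OF dim' a np nq c pa qa m' m(1)] by blast
  have E0: "x \<bullet> p = 0" "x \<bullet> q = 0" "f x q = 0" "f p x = 0" "f x x = 1" if "x \<in> E" for x
    using E(2,5)[OF that] inner_commute[of p x] by (simp_all add: f norm_eq_1)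
  have e0: "f e q = 0" "f p e' = 0" "f e e' \<ge> 1"
    using e by (simp_all add: f)
  have notin: "e \<notin> E" "e' \<notin> E"
    using E(5) e(1,2) by (force simp: norm_eq_1)+
  have "(\<Sum>x\<in>insert e E. A0 x) = 0"
  proof (rule trace0)
    show "pairwise orthogonal (insert e E)"
      using E(1,5) by (auto simp: pairwise_insert orthogonal_def inner_commute)
    show "norm x = 1 \<and> x \<bullet> p = 0 \<and> x \<bullet> \<nu>0 = 0" if "x \<in> insert e E" for x
      using that E(2) E0 e e0 perp0 by blast
  qed (use E notin in auto)
  then have t0: "A0 e + (\<Sum>x\<in>E. A0 x) = 0"
    using E(4) notin by simp
  have "(\<Sum>x\<in>insert e' E. A1 x) = 0"
  proof (rule trace1)
    show "pairwise orthogonal (insert e' E)"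
      using E(1,5) by (auto simp: pairwise_insert orthogonal_def inner_commute)
    show "norm x = 1 \<and> x \<bullet> q = 0 \<and> x \<bullet> \<nu>1 = 0" if "x \<in> insert e' E" for x
      using that E(2) E0 e e0 perp1 by blast
  qed (use E notin in auto)
  then have t1: "A1 e' + (\<Sum>x\<in>E. A1 x) = 0"
    using E(4) notin by simp
  \<comment> \<open>Vectors of \<open>E\<close> are paired with themselves, \<open>e\<close> with
    \<open>e'\<close>. The factors \<open>f \<nu>0 q\<close> and \<open>f p \<nu>1\<close> do not
    depend on the vector, so after summation the traces eliminate all curvature terms.\<close>
  have "A0 x * f \<nu>0 q + A1 x * f p \<nu>1 \<le> m - 1" if "x \<in> E" for x
    using var[of x x] E0[OF that] E(2)[OF that] perp0 perp1 by (simp add: norm_eq_1)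
  then have "(\<Sum>x\<in>E. A0 x * f \<nu>0 q + A1 x * f p \<nu>1) \<le> real (card E) * (m - 1)"
    by (rule sum_bounded_above)
  then have "(\<Sum>x\<in>E. A0 x) * f \<nu>0 q + (\<Sum>x\<in>E. A1 x) * f p \<nu>1 \<le> real (card E) * (m - 1)"
    by (simp add: sum.distrib sum_distrib_right)
  moreover have "A0 e * f \<nu>0 q + A1 e' * f p \<nu>1 \<le> m - 1"
    using var[of e e'] e e0 perp0[of e] perp1[of e'] by (simp add: norm_eq_1)
  ultimately have "(A0 e + (\<Sum>x\<in>E. A0 x)) * f \<nu>0 q + (A1 e' + (\<Sum>x\<in>E. A1 x)) * f p \<nu>1
      \<le> real (card E) * (m - 1) + (m - 1)"
    by (simp add: algebra_simps)
  then have "0 \<le> (real (card E) + 1) * (m - 1)"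
    unfolding t0 t1 by (simp add: algebra_simps)
  then show False
    using m(1) by (simp add: zero_le_mult_iff)
qed

section \<open>The closed hemisphere and tilting of its axis\<close>

lemma closed_hemisphere_subset_closure:
  fixes a x :: "'a::real_inner"
  assumes x: "norm x = 1" "x \<bullet> a \<ge> 0" and a: "norm a = 1"
  shows "x \<in> closure {x \<in> sphere 0 1. x \<bullet> a > 0}"
proof (rule Lim_in_closed_set)
  have "((\<lambda>t. sgn (x + t *\<^sub>R a)) \<longlongrightarrow> sgn (x + 0 *\<^sub>R a)) (at_right (0::real))"
    using x(1) by (intro tendsto_intros) auto
  then show "((\<lambda>t. sgn (x + t *\<^sub>R a)) \<longlongrightarrow> x) (at_right (0::real))"
    using x(1) by (simp add: sgn_div_norm)
  show "\<forall>\<^sub>F t in at_right (0::real). sgn (x + t *\<^sub>R a) \<in> closure {x \<in> sphere 0 1. x \<bullet> a > 0}"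
    using eventually_at_right_less[of 0]
  proof eventually_elim
    case (elim t)
    have pos: "(x + t *\<^sub>R a) \<bullet> a > 0"
      using x(2) a elim by (simp add: inner_add_left norm_eq_1)
    then have "x + t *\<^sub>R a \<noteq> 0"
      by auto
    then have "sgn (x + t *\<^sub>R a) \<in> {x \<in> sphere 0 1. x \<bullet> a > 0}"
      using pos by (simp add: norm_sgn) (simp add: sgn_div_norm)
    then show ?case
      by (rule subsetD[OF closure_subset])
  qed
qed auto

theorem theorem1:
  fixes \<Sigma>0 \<Sigma>1 :: "(real^'n) set" and a :: "real^'n"
  assumes "CARD('n) \<ge> 3"
    and "closed_embedded_minimal_hypersurface \<Sigma>0"
    and "closed_embedded_minimal_hypersurface \<Sigma>1"
    and "norm a = 1"
  shows "closure {x \<in> sphere 0 1. x \<bullet> a > 0} \<inter> \<Sigma>0 \<inter> \<Sigma>1 \<noteq> {}"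
proof
  assume empty: "closure {x \<in> sphere 0 1. x \<bullet> a > 0} \<inter> \<Sigma>0 \<inter> \<Sigma>1 = {}"
  have neg: "x \<bullet> a < 0" if "x \<in> \<Sigma>0 \<inter> \<Sigma>1" for x
    using closed_hemisphere_subset_closure[of x a] empty that assms(4)
      minimal_hypersurface_subset_sphere[OF assms(2)] by fastforce
  \<comment> \<open>By compactness the common points stay a definite amount below the equator;
    \<open>\<eta>\<close> bounds the tilt that keeps them below.\<close>
  have "\<exists>\<eta>>0. \<forall>x\<in>\<Sigma>0 \<inter> \<Sigma>1. x \<bullet> a \<le> - \<eta>"
  proof (cases "\<Sigma>0 \<inter> \<Sigma>1 = {}")
    case False
    have "compact (\<Sigma>0 \<inter> \<Sigma>1)"
      using assms(2,3) minimal_hypersurface_compact compact_Int by blast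
    then have "\<exists>z\<in>\<Sigma>0 \<inter> \<Sigma>1. \<forall>x\<in>\<Sigma>0 \<inter> \<Sigma>1. x \<bullet> a \<le> z \<bullet> a"
      using False by (intro continuous_attains_sup continuous_intros)
    then obtain z where "z \<in> \<Sigma>0 \<inter> \<Sigma>1" "\<And>x. x \<in> \<Sigma>0 \<inter> \<Sigma>1 \<Longrightarrow> x \<bullet> a \<le> z \<bullet> a"
      by blast
    then show ?thesis
      using neg by (intro exI[of _ "- (z \<bullet> a)"]) auto
  qed (auto intro: exI[of _ 1])
  then obtain \<eta> where \<eta>: "\<eta> > 0" "\<And>x. x \<in> \<Sigma>0 \<inter> \<Sigma>1 \<Longrightarrow> x \<bullet> a \<le> - \<eta>"
    by blast
  have perturb: False
    if b: "norm (b - a) < \<eta>" and x0: "x0 \<in> \<Sigma>0" "x0 \<bullet> b > 0" and y0: "y0 \<in> \<Sigma>1" "y0 \<bullet> b > 0" for b x0 y0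
  proof -
    have "b \<noteq> 0"
      using x0 by auto
    then have "\<exists>x\<in>\<Sigma>0 \<inter> \<Sigma>1. x \<bullet> sgn b \<ge> 0"
      using x0 y0 by (intro minimal_hypersurfaces_meet_in_hemisphere[OF assms(1-3), of "sgn b" x0 y0])
        (auto simp: norm_sgn, auto simp: sgn_div_norm)
    then obtain x where x: "x \<in> \<Sigma>0 \<inter> \<Sigma>1" "x \<bullet> b \<ge> 0"
      using \<open>b \<noteq> 0\<close> by (auto simp: sgn_div_norm zero_le_mult_iff)
    have "x \<bullet> (b - a) \<le> norm x * norm (b - a)"
      by (rule norm_cauchy_schwarz)
    then have "x \<bullet> b < x \<bullet> a + \<eta>"
      using b x(1) minimal_hypersurface_subset_sphere[OF assms(2)] by (simp add: inner_diff_right)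
    then show False
      using x \<eta>(2)[of x] by simp
  qed
  obtain p where p: "p \<in> \<Sigma>0" "p \<bullet> a \<ge> 0"
    using minimal_hypersurface_meets_closed_hemisphere[OF assms(1,2)] by blast
  obtain q where q: "q \<in> \<Sigma>1" "q \<bullet> a \<ge> 0"
    using minimal_hypersurface_meets_closed_hemisphere[OF assms(1,3)] by blast
  have np: "norm p = 1" and nq: "norm q = 1"
    using minimal_hypersurface_subset_sphere assms(2,3) p q by blast+
  show False
  proof (cases "q = - p")
    case False
    \<comment> \<open>Tilting towards \<open>p + q\<close> raises both points by the same positive
      amount. Since \<open>norm (p + q) \<le> 2\<close>, the factor \<open>\<eta> / 3\<close> keeps
      the tilt below \<open>\<eta>\<close>.\<close>
    define b where "b = a + (\<eta> / 3) *\<^sub>R (p + q)"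
    have "(p + q) \<bullet> (p + q) > 0"
      using False by (simp add: eq_neg_iff_add_eq_0 add.commute)
    then have pq: "1 + p \<bullet> q > 0"
      using np nq by (simp add: inner_add_left inner_add_right norm_eq_1 inner_commute)
    have "norm (b - a) = \<eta> / 3 * norm (p + q)"
      using \<eta>(1) by (simp add: b_def)
    also have "\<dots> \<le> \<eta> / 3 * 2"
      using \<eta>(1) norm_triangle_ineq[of p q] np nq by (intro mult_left_mono) auto
    finally have "norm (b - a) < \<eta>"
      using \<eta>(1) by simp
    moreover have "p \<bullet> b = p \<bullet> a + \<eta> / 3 * (1 + p \<bullet> q)" "q \<bullet> b = q \<bullet> a + \<eta> / 3 * (1 + p \<bullet> q)"
      using np nq by (simp_all add: b_def inner_add_right norm_eq_1 inner_commute)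
    then have "p \<bullet> b > 0" "q \<bullet> b > 0"
      using p(2) q(2) pq \<eta>(1) by (simp_all add: add_nonneg_pos)
    ultimately show False
      using perturb p(1) q(1) by blast
  next
    case True
    \<comment> \<open>For antipodal points, a tilt that raises one lowers the other. The axis is
      therefore tilted in a direction \<open>v\<close> orthogonal to \<open>p\<close>, which leaves
      both points on the equator.\<close>
    then have pa: "p \<bullet> a = 0"
      using p(2) q(2) by simp
    then have "p \<noteq> a"
      using np by (auto simp: norm_eq_1)
    then have card2: "card {p, a} = 2"
      by simp
    have on: "pairwise orthogonal {p, a}" "\<And>s. s \<in> {p, a} \<Longrightarrow> norm s = 1"
      using pa np assms(4) by (auto simp: pairwise_insert orthogonal_def inner_commute)
    obtain E where E: "\<And>e. e \<in> E \<Longrightarrow> norm e = 1"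
      "\<And>e s. e \<in> E \<Longrightarrow> s \<in> {p, a} \<Longrightarrow> e \<bullet> s = 0" "card E + card {p, a} = DIM(real^'n)"
      by (rule orthonormal_complement[OF on]) auto
    have "card E \<noteq> 0"
      using E(3) card2 assms(1) by simp
    then obtain v where "v \<in> E"
      by fastforce
    then have v: "norm v = 1" "v \<bullet> p = 0" "v \<bullet> a = 0"
      using E by auto
    \<comment> \<open>Any two of the vectors \<open>a + \<epsilon> v\<close> are linearly independent, so at most one of them is
      normal to a given hypersurface at \<open>p\<close> or \<open>- p\<close>.\<close>
    have uniq: "\<epsilon> = \<epsilon>'" if "a + \<epsilon> *\<^sub>R v = k *\<^sub>R \<nu>" "a + \<epsilon>' *\<^sub>R v = k' *\<^sub>R \<nu>" for \<epsilon> \<epsilon>' k k' \<nu>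
    proof -
      have "k' *\<^sub>R (a + \<epsilon> *\<^sub>R v) = k *\<^sub>R (a + \<epsilon>' *\<^sub>R v)"
        by (simp add: that)
      then have eq: "(k' *\<^sub>R (a + \<epsilon> *\<^sub>R v)) \<bullet> z = (k *\<^sub>R (a + \<epsilon>' *\<^sub>R v)) \<bullet> z" for z
        by simp
      have "k' = k" "k' * \<epsilon> = k * \<epsilon>'"
        using eq[of a] eq[of v] v assms(4) inner_commute[of a v]
        by (auto simp: inner_add_left norm_eq_1)
      moreover have "k \<noteq> 0"
      proof
        assume "k = 0"
        then have "(a + \<epsilon> *\<^sub>R v) \<bullet> a = 0"
          using that(1) by simp
        then show False
          using v(3) assms(4) by (simp add: inner_add_left norm_eq_1)
      qed
      ultimately show ?thesis
        by simp
    qed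
    define H where "H \<Sigma> \<epsilon> \<longleftrightarrow> (\<exists>x\<in>\<Sigma>. x \<bullet> (a + \<epsilon> *\<^sub>R v) > 0)" for \<Sigma> \<epsilon>
    have H: "H \<Sigma> \<epsilon> \<or> H \<Sigma> \<epsilon>'"
      if hyps: "closed_embedded_minimal_hypersurface \<Sigma>" "z \<in> \<Sigma>" "z = p \<or> z = - p" "\<epsilon> \<noteq> \<epsilon>'" for \<Sigma> z \<epsilon> \<epsilon>'
    proof (rule ccontr)
      assume "\<not> ?thesis"
      then have le: "\<And>x. x \<in> \<Sigma> \<Longrightarrow> x \<bullet> (a + \<epsilon> *\<^sub>R v) \<le> 0" "\<And>x. x \<in> \<Sigma> \<Longrightarrow> x \<bullet> (a + \<epsilon>' *\<^sub>R v) \<le> 0"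
        by (auto simp: H_def not_less)
      obtain \<nu> where \<nu>: "\<And>b. z \<bullet> b = 0 \<Longrightarrow> (\<And>x. x \<in> \<Sigma> \<Longrightarrow> x \<bullet> b \<le> 0) \<Longrightarrow> \<exists>k. b = k *\<^sub>R \<nu>"
        using minimal_hypersurface_tangent_hyperplane[OF hyps(1,2)] by blast
      have "z \<bullet> (a + s *\<^sub>R v) = 0" for s
        using hyps(3) pa v(2) by (auto simp: inner_add_right inner_commute)
      then obtain k k' where "a + \<epsilon> *\<^sub>R v = k *\<^sub>R \<nu>" "a + \<epsilon>' *\<^sub>R v = k' *\<^sub>R \<nu>"
        using \<nu>[OF _ le(1)] \<nu>[OF _ le(2)] by blast
      then show False
        using uniq hyps(4) by blast
    qed
    have "\<not> (H \<Sigma>0 \<epsilon> \<and> H \<Sigma>1 \<epsilon>)" if "0 < \<epsilon>" "\<epsilon> < \<eta>" for \<epsilon>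
      using perturb[of "a + \<epsilon> *\<^sub>R v"] that v(1) unfolding H_def by auto
    \<comment> \<open>Pigeonhole: each hypersurface rules out at most one of three tilts, so one of
      them works for both.\<close>
    then have "\<not> (H \<Sigma>0 (\<eta> / 2) \<and> H \<Sigma>1 (\<eta> / 2))" "\<not> (H \<Sigma>0 (\<eta> / 3) \<and> H \<Sigma>1 (\<eta> / 3))"
      "\<not> (H \<Sigma>0 (\<eta> / 4) \<and> H \<Sigma>1 (\<eta> / 4))"
      using \<eta>(1) by simp_all
    moreover have "H \<Sigma>0 (\<eta> / 2) \<or> H \<Sigma>0 (\<eta> / 3)" "H \<Sigma>0 (\<eta> / 2) \<or> H \<Sigma>0 (\<eta> / 4)"
      "H \<Sigma>0 (\<eta> / 3) \<or> H \<Sigma>0 (\<eta> / 4)"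
      using \<eta>(1) by (intro H[OF assms(2) p(1)]; simp)+
    moreover have "H \<Sigma>1 (\<eta> / 2) \<or> H \<Sigma>1 (\<eta> / 3)" "H \<Sigma>1 (\<eta> / 2) \<or> H \<Sigma>1 (\<eta> / 4)"
      "H \<Sigma>1 (\<eta> / 3) \<or> H \<Sigma>1 (\<eta> / 4)"
      using \<eta>(1) True by (intro H[OF assms(3) q(1)]; simp)+
    ultimately show False
      by blast
  qed
qed

end
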